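(* Let $\varphi$ be an analytic function in the unit disk $\mathbb{D}=\{z\in\mathbb{C}:|z|<1\}$ with Taylor series $\varphi(z)=\sum_{n=0}^\infty \lambda_n z^n$. Then the following four conditions are equivalent: (a) $\varphi$ is an inner function; (b) $\varphi$ is an isometric pointwise multiplier of the Hardy space $H^2$ into itself; in other words, for every $f\in H^2$ one has $\varphi f\in H^2$ and $\|\varphi f\|_2=\|f\|_2$; (c) the equality $$\sum_{n=0}^\infty \left|\sum_{j=0}^n a_j\lambda_{n-j}\right|^2=\sum_{n=0}^\infty |a_n|^2$$ holds for all square-summable sequences $(a_n)_{n=0}^\infty$ of complex numbers; (d) the equality $$\sum_{n=0}^N \left|\sum_{j=0}^n a_j\lambda_{n-j}\right|^2+\sum_{n=N+1}^\infty \left|\sum_{j=0}^N a_j\lambda_{n-j}\right|^2=\sum_{n=0}^N |a_n|^2$$ holds for all non-negative integers $N$ and all $(a_0,a_1,\ldots,a_N)\in\mathbb{C}^{N+1}$.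
   Context: The Hardy space $H^2$ is the Hilbert space of all functions $f$ analytic in $\mathbb{D}$ for which $$\|f\|_2=\lim_{r\to1^-}\left(\int_0^{2\pi}|f(re^{i\theta})|^2\,\frac{d\theta}{2\pi}\right)^{1/2}<\infty.$$ For $f(z)=\sum_{n=0}^\infty a_nz^n$ one has $\|f\|_2^2=\sum_{n=0}^\infty|a_n|^2$. An inner function is an analytic function $\varphi$ in $\mathbb{D}$ with $|\varphi(z)|\le 1$ for all $z\in\mathbb{D}$ whose radial boundary values $\varphi(e^{i\theta})=\lim_{r\to1^-}\varphi(re^{i\theta})$ satisfy $|\varphi(e^{i\theta})|=1$ for almost every $\theta$ (unimodular constants are included). In (c) and (d), the equality is understood to include the convergence of the infinite series on the left-hand side. *)

theory Defs
  imports "HOL-Complex_Analysis.Complex_Analysis"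
begin

definition hardy_mean :: "(complex \<Rightarrow> complex) \<Rightarrow> real \<Rightarrow> real" where
  "hardy_mean f r =
     sqrt (integral {0..2*pi} (\<lambda>\<theta>. (cmod (f (of_real r * cis \<theta>)))\<^sup>2 / (2 * pi)))"

text \<open>
  For \<open>f\<close> holomorphic on the disk the means increase with \<open>r\<close>, so their limit from the left at \<open>1\<close>
  always exists in \<open>[0, \<infinity>]\<close>; its finiteness is the existence of a real limit.
  Functions are total on the complex plane; their values off the open disk play no role.
\<close>

definition hardy_space :: "(complex \<Rightarrow> complex) set" where
  "hardy_space =
     {f. f holomorphic_on ball 0 1 \<and> (\<exists>L::real. (hardy_mean f \<longlongrightarrow> L) (at_left 1))}"

definition hardy_norm :: "(complex \<Rightarrow> complex) \<Rightarrow> real" where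
  "hardy_norm f = Lim (at_left 1) (hardy_mean f)"

definition inner_function :: "(complex \<Rightarrow> complex) \<Rightarrow> bool" where
  "inner_function f \<longleftrightarrow>
     f holomorphic_on ball 0 1 \<and>
     (\<forall>z\<in>ball 0 1. cmod (f z) \<le> 1) \<and>
     (AE \<theta> in lebesgue_on {0..2*pi}.
        \<exists>w. ((\<lambda>r::real. f (of_real r * cis \<theta>)) \<longlongrightarrow> w) (at_left 1) \<and> cmod w = 1)"

end

theory Submission
  imports Defs
begin

text \<open>
  By Parseval, \<open>hardy_mean f r\<close> squared is the sum of \<open>|b\<^sub>n|\<^sup>2 r\<^sup>2\<^sup>n\<close> over the Taylor coefficients of \<open>f\<close>, so
  \<open>H\<^sup>2\<close> is the space of power series with square-summable coefficients, and (b), (c), (d) all say that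
  multiplication by \<open>\<phi>\<close>, acting on coefficients by convolution with \<open>l\<close>, is isometric. Passing from
  finitely supported to all square-summable sequences is a density argument. For an inner \<open>\<phi>\<close> and a
  polynomial \<open>p\<close>, dominated convergence along radii gives that the norms of \<open>\<phi> p\<close> and \<open>p\<close> agree, which is (d).

  Conversely, if multiplication by \<open>\<phi>\<close> is isometric then every power of \<open>\<phi>\<close> has norm \<open>1\<close>; since point
  evaluations are bounded, \<open>|\<phi>|\<^sup>k\<close> is bounded at each point uniformly in \<open>k\<close>, so \<open>|\<phi>| \<le> 1\<close>. As the norm is \<open>1\<close>,
  along radii \<open>r\<^sub>k\<close> tending to \<open>1\<close> fast enough the functions \<open>\<phi>(r\<^sub>k e\<^sup>i\<^sup>\<theta>)\<close> converge almost everywhere to some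
  \<open>g\<close> with \<open>|g| = 1\<close>. To upgrade this to radial limits (Fatou), let \<open>G\<close> be a primitive of \<open>\<phi>\<close>. It is Lipschitz,
  so it extends to the closed disk, and on the circle it is an indefinite integral of \<open>g\<close>; by Lebesgue
  differentiation it is differentiable along the circle almost everywhere. At such a point \<open>w\<close> a maximum principle
  shows that \<open>G(z) - G(w) - g (z - w)\<close> is \<open>o(|z - w|)\<close> in the whole disk, and Cauchy's estimate on disks of
  radius \<open>(1 - r) / 2\<close> turns this into \<open>\<phi>(r w) \<rightarrow> g\<close>.
\<close>

section \<open>Parseval's identity and Taylor coefficients\<close>

lemma has_integral_cis_int:
  fixes k :: int
  shows "((\<lambda>\<theta>. cis (of_int k * \<theta>)) has_integral (if k = 0 then 2 * pi else 0)) {0..2*pi}"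
proof (cases "k = 0")
  case True
  then show ?thesis
    using has_integral_const_real[of "1::complex" 0 "2*pi"] by (simp add: scaleR_conv_of_real)
next
  case False
  have "((\<lambda>\<theta>. exp (\<i> * of_int k * of_real \<theta>)) has_integral
      (exp (\<i> * of_int k * of_real (2*pi)) / (\<i> * of_int k) - exp (\<i> * of_int k * of_real 0) / (\<i> * of_int k))) {0..2*pi}"
  proof (rule fundamental_theorem_of_calculus)
    fix x :: real
    have "((\<lambda>z. exp (\<i> * of_int k * z) / (\<i> * of_int k)) has_field_derivative exp (\<i> * of_int k * of_real x)) (at (of_real x))"
      using False by (auto intro!: derivative_eq_intros)
    then show "((\<lambda>\<theta>. exp (\<i> * of_int k * of_real \<theta>) / (\<i> * of_int k)) has_vector_derivative
          exp (\<i> * of_int k * of_real x)) (at x within {0..2*pi})"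
      by (intro has_vector_derivative_real_field) (auto)
  qed simp
  moreover have "exp (\<i> * of_int k * of_real (2*pi)) = 1"
    using exp_integer_2pi[of "of_int k"] by (simp add: mult_ac)
  ultimately show ?thesis using False by (simp add: cis_conv_exp mult_ac)
qed

text \<open>Written as \<open>z * cnj z\<close>, the squared modulus expands into a double sum, and
  orthogonality of the characters \<open>cis (k * \<theta>)\<close> leaves only its
  diagonal.\<close>

lemma has_integral_cmod_trig_poly:
  "((\<lambda>\<theta>. (cmod (\<Sum>n<N. b n * cis (real n * \<theta>)))\<^sup>2) has_integral 2 * pi * (\<Sum>n<N. (cmod (b n))\<^sup>2)) {0..2*pi}"
proof -
  have eq: "complex_of_real ((cmod (\<Sum>n<N. b n * cis (real n * \<theta>)))\<^sup>2)
      = (\<Sum>n<N. \<Sum>m<N. b n * cnj (b m) * cis (of_int (int n - int m) * \<theta>))" for \<theta>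
  proof -
    have "cis (of_int (int n - int m) * \<theta>) = cis (real n * \<theta>) * cis (- (real m * \<theta>))" for n m
      by (simp add: cis_mult left_diff_distrib)
    then show ?thesis
      unfolding complex_norm_square cnj_sum sum_product
      by (intro sum.cong refl) (simp add: cis_cnj mult_ac)
  qed
  have int: "((\<lambda>\<theta>. complex_of_real ((cmod (\<Sum>n<N. b n * cis (real n * \<theta>)))\<^sup>2)) has_integral
      (\<Sum>n<N. \<Sum>m<N. b n * cnj (b m) * (if int n - int m = 0 then 2 * pi else 0))) {0..2*pi}"
    unfolding eq by (intro has_integral_sum has_integral_mult_right has_integral_cis_int) auto
  have sum_eq: "(\<Sum>n<N. \<Sum>m<N. b n * cnj (b m) * (if int n - int m = 0 then 2 * pi else 0))
      = complex_of_real (2 * pi * (\<Sum>n<N. (cmod (b n))\<^sup>2))"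
  proof -
    have "(\<Sum>m<N. b n * cnj (b m) * (if int n - int m = 0 then 2 * pi else 0))
        = of_real (2 * pi * (cmod (b n))\<^sup>2)" if "n < N" for n
    proof -
      have "(\<Sum>m<N. b n * cnj (b m) * (if int n - int m = 0 then 2 * pi else 0))
          = (\<Sum>m<N. if n = m then b n * cnj (b n) * of_real (2 * pi) else 0)"
        by (intro sum.cong) auto
      then show ?thesis
        using that unfolding of_real_mult complex_norm_square by (simp add: mult_ac)
    qed
    then show ?thesis by (simp add: sum_distrib_left)
  qed
  show ?thesis
    using has_integral_linear[OF int[unfolded sum_eq] bounded_linear_Re] unfolding o_def Re_complex_of_real .
qed

lemma hardy_mean_nonneg: "0 \<le> hardy_mean f r"
proof -
  let ?g = "\<lambda>\<theta>. (cmod (f (of_real r * cis \<theta>)))\<^sup>2 / (2 * pi)"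
  have "0 \<le> integral {0..2*pi} ?g"
    \<comment> \<open>For a non-integrable integrand \<open>integral\<close> takes its default value
      0.\<close>
    by (cases "?g integrable_on {0..2*pi}")
      (simp_all add: Henstock_Kurzweil_Integration.integral_nonneg not_integrable_integral del: integral_divide)
  then show ?thesis unfolding hardy_mean_def by simp
qed

lemma summable_norm_power_series:
  assumes "\<And>z. z \<in> ball 0 1 \<Longrightarrow> (\<lambda>n. b n * z ^ n) sums f z" and "cmod z < 1"
  shows "summable (\<lambda>n. cmod (b n * z ^ n))"
proof -
  obtain s where "cmod z < s" "s < 1" using assms(2) dense by blast
  moreover then have "summable (\<lambda>n. b n * of_real s ^ n)"
    using assms(1)[of "of_real s"] norm_ge_zero[of z] by (intro sums_summable) auto
  ultimately show ?thesis using norm_ge_zero[of z] by (intro powser_insidea) auto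
qed

text \<open>On a circle of radius \<open>r < 1\<close> the Taylor sums converge uniformly, so
  Parseval for trigonometric polynomials passes to the limit. The second form also records that the
  squared modulus is integrable.\<close>

lemma hardy_mean_parseval:
  assumes sums: "\<And>z. z \<in> ball 0 1 \<Longrightarrow> (\<lambda>n. b n * z ^ n) sums f z"
    and r: "0 \<le> r" "r < 1"
  shows "(\<lambda>n. (cmod (b n))\<^sup>2 * r ^ (2 * n)) sums (hardy_mean f r)\<^sup>2"
    and "((\<lambda>\<theta>. (cmod (f (of_real r * cis \<theta>)))\<^sup>2) has_integral 2 * pi * (hardy_mean f r)\<^sup>2) {0..2*pi}"
proof -
  define S where "S N \<theta> = (\<Sum>n<N. b n * of_real r ^ n * cis (real n * \<theta>))" for N \<theta>
  have term_eq: "b n * (of_real r * cis \<theta>) ^ n = b n * of_real r ^ n * cis (real n * \<theta>)" for n \<theta>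
    by (simp add: power_mult_distrib Complex.DeMoivre)
  have "uniform_limit UNIV (\<lambda>N \<theta>. \<Sum>n<N. b n * of_real r ^ n * cis (real n * \<theta>))
      (\<lambda>\<theta>. \<Sum>n. b n * of_real r ^ n * cis (real n * \<theta>)) sequentially"
    using summable_norm_power_series[OF sums, of "of_real r"] r
    by (intro Weierstrass_m_test[where M="\<lambda>n. cmod (b n * of_real r ^ n)"]) (auto simp: norm_mult)
  moreover have "(\<Sum>n. b n * of_real r ^ n * cis (real n * \<theta>)) = f (of_real r * cis \<theta>)" for \<theta>
    using sums[of "of_real r * cis \<theta>"] r by (simp add: term_eq sums_iff norm_mult)
  ultimately have lim: "uniform_limit {0..2*pi} S (\<lambda>\<theta>. f (of_real r * cis \<theta>)) sequentially"
    unfolding S_def by (auto intro: uniform_limit_on_subset)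
  have cont: "continuous_on {0..2*pi} (S N)" for N
    unfolding S_def by (intro continuous_intros)
  have contf: "continuous_on {0..2*pi} (\<lambda>\<theta>. f (of_real r * cis \<theta>))"
    using uniform_limit_theorem[OF _ lim] cont by simp
  \<comment> \<open>Uniform limits may be multiplied when the limit functions are bounded; this is
    applied to \<open>S N \<theta>\<close> and its conjugate.\<close>
  have "bounded ((\<lambda>\<theta>. f (of_real r * cis \<theta>)) ` {0..2*pi})"
    by (intro compact_imp_bounded compact_continuous_image contf) simp
  then have "uniform_limit {0..2*pi} (\<lambda>N \<theta>. S N \<theta> * cnj (S N \<theta>))
      (\<lambda>\<theta>. f (of_real r * cis \<theta>) * cnj (f (of_real r * cis \<theta>))) sequentially"
    by (intro uniform_lim_mult lim bounded_linear.uniform_limit[OF bounded_linear_cnj])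
       (auto simp: image_comp bounded_iff)
  then have "uniform_limit {0..2*pi} (\<lambda>N \<theta>. Re (S N \<theta> * cnj (S N \<theta>)))
      (\<lambda>\<theta>. Re (f (of_real r * cis \<theta>) * cnj (f (of_real r * cis \<theta>)))) sequentially"
    by (rule bounded_linear.uniform_limit[OF bounded_linear_Re])
  then have lim2: "uniform_limit {0..2*pi} (\<lambda>N \<theta>. (cmod (S N \<theta>))\<^sup>2)
      (\<lambda>\<theta>. (cmod (f (of_real r * cis \<theta>)))\<^sup>2) sequentially"
    by (simp flip: complex_norm_square of_real_power)
  obtain I J where I: "\<And>N. ((\<lambda>\<theta>. (cmod (S N \<theta>))\<^sup>2) has_integral I N) {0..2*pi}"
    and J: "((\<lambda>\<theta>. (cmod (f (of_real r * cis \<theta>)))\<^sup>2) has_integral J) {0..2*pi}" and IJ: "I \<longlonglongrightarrow> J"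
  proof (rule uniform_limit_integral[OF lim2])
    show "continuous_on {0..2*pi} (\<lambda>\<theta>. (cmod (S N \<theta>))\<^sup>2)" for N
      by (intro continuous_intros cont)
  qed (simp, rule that)
  have "I N = 2 * pi * (\<Sum>n<N. (cmod (b n))\<^sup>2 * r ^ (2 * n))" for N
    using has_integral_unique[OF I has_integral_cmod_trig_poly[where N=N and b="\<lambda>n. b n * of_real r ^ n", folded S_def]] r
    by (simp add: norm_mult norm_power power_mult_distrib power_mult mult_ac)
  then have "(\<lambda>N. 2 * pi * (\<Sum>n<N. (cmod (b n))\<^sup>2 * r ^ (2 * n))) \<longlonglongrightarrow> J" using IJ by presburger
  from tendsto_divide[OF this tendsto_const[of "2*pi"]]
  have *: "(\<lambda>n. (cmod (b n))\<^sup>2 * r ^ (2 * n)) sums (J / (2*pi))" by (simp add: sums_def)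
  have "0 \<le> J" using has_integral_nonneg[OF J] by simp
  moreover have "integral {0..2*pi} (\<lambda>\<theta>. (cmod (f (of_real r * cis \<theta>)))\<^sup>2 / (2*pi)) = J / (2*pi)"
    using has_integral_divide[OF J] by (intro integral_unique) auto
  ultimately have J_eq: "(hardy_mean f r)\<^sup>2 = J / (2*pi)" unfolding hardy_mean_def by simp
  show "(\<lambda>n. (cmod (b n))\<^sup>2 * r ^ (2 * n)) sums (hardy_mean f r)\<^sup>2" using * J_eq by simp
  show "((\<lambda>\<theta>. (cmod (f (of_real r * cis \<theta>)))\<^sup>2) has_integral 2 * pi * (hardy_mean f r)\<^sup>2) {0..2*pi}"
    using J J_eq by simp
qed

text \<open>The terms of \<open>?A\<close> are dominated on \<open>{0..1}\<close> by their values at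
  \<open>r = 1\<close>, so \<open>?A\<close> converges uniformly up to the endpoint and is
  continuous there.\<close>

lemma hardy_mean_tendsto:
  assumes sums: "\<And>z. z \<in> ball 0 1 \<Longrightarrow> (\<lambda>n. b n * z ^ n) sums f z"
    and summ: "summable (\<lambda>n. (cmod (b n))\<^sup>2)"
  shows "(hardy_mean f \<longlongrightarrow> sqrt (\<Sum>n. (cmod (b n))\<^sup>2)) (at_left 1)"
proof -
  let ?A = "\<lambda>r::real. \<Sum>n. (cmod (b n))\<^sup>2 * r ^ (2 * n)"
  have "uniform_limit {0..1} (\<lambda>N r. \<Sum>n<N. (cmod (b n))\<^sup>2 * r ^ (2 * n)) ?A sequentially"
    by (rule Weierstrass_m_test[OF _ summ]) (auto simp: abs_mult power_abs intro!: mult_left_le power_le_one)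
  then have "continuous_on {0..1} ?A"
    by (rule uniform_limit_theorem[rotated]) (auto intro!: always_eventually continuous_intros)
  then have "(?A \<longlongrightarrow> ?A 1) (at_left 1)"
    using continuous_on_Icc_at_leftD[of 0 1 ?A] by simp
  then have "((\<lambda>r. sqrt (?A r)) \<longlongrightarrow> sqrt (\<Sum>n. (cmod (b n))\<^sup>2)) (at_left 1)"
    by (intro tendsto_real_sqrt) simp
  moreover have "eventually (\<lambda>r. sqrt (?A r) = hardy_mean f r) (at_left (1::real))"
  proof (rule eventually_mono)
    show "eventually (\<lambda>r. r \<in> {0<..<1}) (at_left (1::real))"
      using eventually_at_left_real[of 0 "1::real"] by simp
  next
    fix r :: real assume "r \<in> {0<..<1}"
    then show "sqrt (?A r) = hardy_mean f r"
      using hardy_mean_parseval(1)[OF sums, of r] hardy_mean_nonneg[of f r] by (simp add: sums_iff)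
  qed
  ultimately show ?thesis by (rule Lim_transform_eventually)
qed

text \<open>A converse to \<open>hardy_mean_tendsto\<close> along a single sequence of radii. Each
  weighted partial sum lies below the corresponding mean, so in the limit all partial sums lie below
  \<open>L\<close>; once summability is known, \<open>hardy_mean_tendsto\<close> identifies
  \<open>L\<close>.\<close>

lemma sums_cmod_square_coeffs:
  assumes sums: "\<And>z. z \<in> ball 0 1 \<Longrightarrow> (\<lambda>n. b n * z ^ n) sums f z"
    and r: "\<And>k. 0 \<le> r k" "\<And>k. r k < 1" "r \<longlonglongrightarrow> 1"
    and lim: "(\<lambda>k. (hardy_mean f (r k))\<^sup>2) \<longlonglongrightarrow> L"
  shows "(\<lambda>n. (cmod (b n))\<^sup>2) sums L"
proof -
  have "(\<Sum>n<N. (cmod (b n))\<^sup>2) \<le> L" for N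
  proof (rule LIMSEQ_le[OF _ lim])
    show "(\<lambda>k. \<Sum>n<N. (cmod (b n))\<^sup>2 * r k ^ (2 * n)) \<longlonglongrightarrow> (\<Sum>n<N. (cmod (b n))\<^sup>2)"
    proof -
      have "(\<lambda>k. \<Sum>n<N. (cmod (b n))\<^sup>2 * r k ^ (2 * n)) \<longlonglongrightarrow> (\<Sum>n<N. (cmod (b n))\<^sup>2 * 1 ^ (2 * n))"
        by (intro tendsto_intros r)
      then show ?thesis by simp
    qed
    have "(\<Sum>n<N. (cmod (b n))\<^sup>2 * r k ^ (2 * n)) \<le> (hardy_mean f (r k))\<^sup>2" for k
    proof -
      note P = hardy_mean_parseval(1)[OF sums r(1)[of k] r(2)[of k]]
      show ?thesis
        using sum_le_suminf[OF sums_summable[OF P], of "{..<N}"] sums_unique[OF P] r(1) by simp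
    qed
    then show "\<exists>M. \<forall>k\<ge>M. (\<Sum>n<N. (cmod (b n))\<^sup>2 * r k ^ (2 * n)) \<le> (hardy_mean f (r k))\<^sup>2"
      by blast
  qed
  then have summ: "summable (\<lambda>n. (cmod (b n))\<^sup>2)"
    by (intro bounded_imp_summable[of _ L]) (simp_all del: sum.lessThan_Suc flip: lessThan_Suc_atMost)
  have "filterlim r (at_left 1) sequentially"
    using r by (auto simp: filterlim_at less_le intro!: always_eventually)
  from tendsto_power[OF filterlim_compose[OF hardy_mean_tendsto[OF sums summ] this], of 2]
  have "(\<lambda>k. (hardy_mean f (r k))\<^sup>2) \<longlonglongrightarrow> (\<Sum>n. (cmod (b n))\<^sup>2)"
    using suminf_nonneg[OF summ] by simp
  then have "L = (\<Sum>n. (cmod (b n))\<^sup>2)" using lim LIMSEQ_unique by blast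
  then show ?thesis using summ by (simp add: sums_iff)
qed

lemma radii_to_1:
  fixes r :: "nat \<Rightarrow> real"
  defines "r \<equiv> \<lambda>k. 1 - inverse (real (Suc k))"
  shows "0 \<le> r k" "r k < 1" "r \<longlonglongrightarrow> 1" "filterlim r (at_left 1) sequentially"
proof -
  show *: "0 \<le> r k" "r k < 1" for k by (auto simp: r_def divide_simps)
  show "r \<longlonglongrightarrow> 1"
    unfolding r_def using LIMSEQ_inverse_real_of_nat_add_minus[of 1] by simp
  then show "filterlim r (at_left 1) sequentially"
    using * by (auto simp: filterlim_at less_le intro!: always_eventually)
qed

section \<open>The Hardy space and its multipliers in terms of Taylor coefficients\<close>

lemma hardy_space_iff_summable:
  assumes sums: "\<And>z. z \<in> ball 0 1 \<Longrightarrow> (\<lambda>n. b n * z ^ n) sums f z"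
  shows "f \<in> hardy_space \<longleftrightarrow> summable (\<lambda>n. (cmod (b n))\<^sup>2)"
    and "f \<in> hardy_space \<Longrightarrow> hardy_norm f = sqrt (\<Sum>n. (cmod (b n))\<^sup>2)"
proof -
  have hol: "f holomorphic_on ball 0 1"
    using power_series_holomorphic[of 0 1 b f] sums by simp
  show iff: "f \<in> hardy_space \<longleftrightarrow> summable (\<lambda>n. (cmod (b n))\<^sup>2)"
  proof
    assume "f \<in> hardy_space"
    then obtain L where "(hardy_mean f \<longlongrightarrow> L) (at_left 1)" unfolding hardy_space_def by blast
    from tendsto_power[OF filterlim_compose[OF this radii_to_1(4)], of 2]
    show "summable (\<lambda>n. (cmod (b n))\<^sup>2)"
      using sums_cmod_square_coeffs[OF sums radii_to_1(1-3)] by (auto simp: sums_iff)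
  qed (use hol hardy_mean_tendsto[OF sums] in \<open>auto simp: hardy_space_def\<close>)
  show "hardy_norm f = sqrt (\<Sum>n. (cmod (b n))\<^sup>2)" if "f \<in> hardy_space"
    using that hardy_mean_tendsto[OF sums] iff unfolding hardy_norm_def
    by (intro tendsto_Lim) auto
qed

text \<open>Cauchy product of absolutely convergent series. The product is written
  \<open>g z * f z\<close> so that a multiplier put for \<open>g\<close> stands on the left, as in
  (b).\<close>

lemma power_series_mult_sums:
  fixes a b :: "nat \<Rightarrow> complex"
  assumes "\<And>z. z \<in> ball 0 1 \<Longrightarrow> (\<lambda>n. a n * z ^ n) sums f z"
    and "\<And>z. z \<in> ball 0 1 \<Longrightarrow> (\<lambda>n. b n * z ^ n) sums g z"
    and z: "z \<in> ball 0 1"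
  shows "(\<lambda>n. (\<Sum>j\<le>n. a j * b (n - j)) * z ^ n) sums (g z * f z)"
proof -
  have "summable (\<lambda>n. cmod (a n * z ^ n))" "summable (\<lambda>n. cmod (b n * z ^ n))"
    using summable_norm_power_series[OF assms(1)] summable_norm_power_series[OF assms(2)] z by auto
  then have "(\<lambda>n. \<Sum>j\<le>n. (a j * z ^ j) * (b (n - j) * z ^ (n - j))) sums ((\<Sum>n. a n * z ^ n) * (\<Sum>n. b n * z ^ n))"
    by (rule Cauchy_product_sums)
  moreover have "(\<Sum>j\<le>n. (a j * z ^ j) * (b (n - j) * z ^ (n - j))) = (\<Sum>j\<le>n. a j * b (n - j)) * z ^ n" for n
    unfolding sum_distrib_right by (intro sum.cong refl) (simp add: mult_ac flip: power_add)
  ultimately show ?thesis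
    using assms(1)[OF z] assms(2)[OF z] by (simp add: sums_iff mult_ac)
qed

text \<open>Turns a square-summable sequence into a function on the disk. The bound
  \<open>x * y \<le> x\<^sup>2 + y\<^sup>2\<close> splits each term into a square-summable part and
  a geometric one.\<close>

lemma square_summable_power_series_sums:
  assumes "summable (\<lambda>n. (cmod (a n))\<^sup>2)" and "z \<in> ball 0 1"
  shows "(\<lambda>n. a n * z ^ n) sums (\<Sum>n. a n * z ^ n)"
proof (rule summable_sums, rule summable_comparison_test)
  have "summable (\<lambda>n. ((cmod z)\<^sup>2) ^ n)"
    using assms(2) by (intro summable_geometric) (auto simp: abs_square_less_1)
  then show "summable (\<lambda>n. (cmod (a n))\<^sup>2 + ((cmod z)\<^sup>2) ^ n)"
    using assms(1) by (rule summable_add[rotated])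
  have "cmod (a n) * cmod z ^ n \<le> (cmod (a n))\<^sup>2 + (cmod z ^ n)\<^sup>2" for n
    using sum_squares_bound[of "cmod (a n)" "cmod z ^ n"]
      zero_le_mult_iff[of "cmod (a n)" "cmod z ^ n"] zero_le_power[OF norm_ge_zero, of z n]
      norm_ge_zero[of "a n"] by linarith
  then show "\<exists>N. \<forall>n\<ge>N. norm (a n * z ^ n) \<le> (cmod (a n))\<^sup>2 + ((cmod z)\<^sup>2) ^ n"
    unfolding norm_mult norm_power power_mult[symmetric] mult.commute[of 2] by blast
qed

text \<open>Taylor coefficients match functions in \<open>hardy_space\<close> with square-summable
  sequences and turn multiplication by \<open>\<phi>\<close> into the Cauchy product with
  \<open>l\<close>. \<open>equiv\<close> says this for one matching pair; the two directions differ
  in which member of the pair is given.\<close>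

lemma isometric_multiplier_iff:
  assumes sums: "\<And>z. z \<in> ball 0 1 \<Longrightarrow> (\<lambda>n. l n * z ^ n) sums \<phi> z"
  shows "(\<forall>f\<in>hardy_space. (\<lambda>z. \<phi> z * f z) \<in> hardy_space \<and> hardy_norm (\<lambda>z. \<phi> z * f z) = hardy_norm f)
    \<longleftrightarrow> (\<forall>a. summable (\<lambda>n. (cmod (a n))\<^sup>2) \<longrightarrow>
          (\<lambda>n. (cmod (\<Sum>j\<le>n. a j * l (n - j)))\<^sup>2) sums (\<Sum>n. (cmod (a n))\<^sup>2))"
  (is "?B \<longleftrightarrow> ?C")
proof -
  have equiv: "f \<in> hardy_space \<longleftrightarrow> summable (\<lambda>n. (cmod (a n))\<^sup>2)"
    "f \<in> hardy_space \<Longrightarrow> ((\<lambda>z. \<phi> z * f z) \<in> hardy_space \<and> hardy_norm (\<lambda>z. \<phi> z * f z) = hardy_norm f) \<longleftrightarrow>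
        (\<lambda>n. (cmod (\<Sum>j\<le>n. a j * l (n - j)))\<^sup>2) sums (\<Sum>n. (cmod (a n))\<^sup>2)"
    if "\<And>z. z \<in> ball 0 1 \<Longrightarrow> (\<lambda>n. a n * z ^ n) sums f z" for a f
    using hardy_space_iff_summable[OF that]
      hardy_space_iff_summable[OF power_series_mult_sums[OF that sums]]
    by (auto simp: sums_iff)
  show ?thesis
  proof (intro iffI allI impI ballI)
    fix a assume ?B and a: "summable (\<lambda>n. (cmod (a n))\<^sup>2)"
    have "(\<lambda>n. a n * z ^ n) sums (\<Sum>n. a n * z ^ n)" if "z \<in> ball 0 1" for z
      using square_summable_power_series_sums[OF a that] .
    note equiv_f = equiv[OF this]
    have f: "(\<lambda>z. \<Sum>n. a n * z ^ n) \<in> hardy_space" using equiv_f(1) a by simp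
    show "(\<lambda>n. (cmod (\<Sum>j\<le>n. a j * l (n - j)))\<^sup>2) sums (\<Sum>n. (cmod (a n))\<^sup>2)"
      using equiv_f(2)[OF _ f] bspec[OF \<open>?B\<close> f] by simp
  next
    fix f assume ?C and f: "f \<in> hardy_space"
    then have "f holomorphic_on ball 0 1" by (simp add: hardy_space_def)
    then have "(\<lambda>n. (deriv ^^ n) f 0 / fact n * z ^ n) sums f z" if "z \<in> ball 0 1" for z
      using holomorphic_power_series[of f 0 1 z] that by simp
    note equiv_f = equiv[OF this]
    show "(\<lambda>z. \<phi> z * f z) \<in> hardy_space \<and> hardy_norm (\<lambda>z. \<phi> z * f z) = hardy_norm f"
      using equiv_f(2)[OF _ f] equiv_f(1) f spec[OF \<open>?C\<close>, of "\<lambda>n. (deriv ^^ n) f 0 / fact n"] by blast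
  qed
qed

section \<open>Isometry on sequences\<close>

text \<open>Density in two halves: truncation shows that convolution with \<open>l\<close> does not
  increase norms, and the triangle inequality with a vanishing tail shows that it does not decrease
  them.\<close>

lemma square_summable_isometry_iff_finite:
  fixes l :: "nat \<Rightarrow> complex"
  shows "(\<forall>a. summable (\<lambda>n. (cmod (a n))\<^sup>2) \<longrightarrow>
            (\<lambda>n. (cmod (\<Sum>j\<le>n. a j * l (n - j)))\<^sup>2) sums (\<Sum>n. (cmod (a n))\<^sup>2))
    \<longleftrightarrow> (\<forall>N a. (\<forall>n>N. a n = 0) \<longrightarrow>
            (\<lambda>n. (cmod (\<Sum>j\<le>n. a j * l (n - j)))\<^sup>2) sums (\<Sum>n\<le>N. (cmod (a n))\<^sup>2))"
  (is "?C \<longleftrightarrow> ?D")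
proof
  assume ?C
  show ?D
  proof (intro allI impI)
    fix N and a :: "nat \<Rightarrow> complex" assume "\<forall>n>N. a n = 0"
    then have "(\<lambda>n. (cmod (a n))\<^sup>2) sums (\<Sum>n\<le>N. (cmod (a n))\<^sup>2)"
      by (intro sums_finite) auto
    then show "(\<lambda>n. (cmod (\<Sum>j\<le>n. a j * l (n - j)))\<^sup>2) sums (\<Sum>n\<le>N. (cmod (a n))\<^sup>2)"
      using \<open>?C\<close> by (auto simp: sums_iff)
  qed
next
  assume D: ?D
  define T where "T a n = (\<Sum>j\<le>n. a j * l (n - j))" for a n
  define trunc where "trunc N a n = (if n \<le> N then a n else 0)" for N n and a :: "nat \<Rightarrow> complex"
  have D': "(\<lambda>n. (cmod (T (trunc N a) n))\<^sup>2) sums (\<Sum>n\<le>N. (cmod (a n))\<^sup>2)" for N a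
  proof -
    have "(\<lambda>n. (cmod (T (trunc N a) n))\<^sup>2) sums (\<Sum>n\<le>N. (cmod (trunc N a n))\<^sup>2)"
      using D[rule_format, of N "trunc N a"] by (simp add: T_def trunc_def)
    then show ?thesis by (simp add: trunc_def)
  qed
  \<comment> \<open>Entry \<open>n\<close> of \<open>T a\<close> involves \<open>a\<close> only up
    to index \<open>n\<close>, so truncating \<open>a\<close> at \<open>M\<close> leaves the first
    \<open>M\<close> entries of \<open>T a\<close> unchanged and the finite isometry
    \<open>D'\<close> applies.\<close>
  have upper: "(\<Sum>n<M. (cmod (T a n))\<^sup>2) \<le> (\<Sum>n. (cmod (a n))\<^sup>2)"
    if "summable (\<lambda>n. (cmod (a n))\<^sup>2)" for a M
  proof -
    have "(\<Sum>n<M. (cmod (T a n))\<^sup>2) = (\<Sum>n<M. (cmod (T (trunc M a) n))\<^sup>2)"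
      by (intro sum.cong refl arg_cong[where f="\<lambda>x. (cmod x)\<^sup>2"]) (auto simp: T_def trunc_def)
    also have "\<dots> \<le> (\<Sum>n. (cmod (T (trunc M a) n))\<^sup>2)"
      using D'[of M a] by (intro sum_le_suminf) (auto simp: sums_iff)
    also have "\<dots> = (\<Sum>n\<le>M. (cmod (a n))\<^sup>2)"
      using D'[of M a] by (simp add: sums_iff)
    also have "\<dots> \<le> (\<Sum>n. (cmod (a n))\<^sup>2)"
      using that by (intro sum_le_suminf) auto
    finally show ?thesis .
  qed
  show ?C
  proof (intro allI impI)
    fix a :: "nat \<Rightarrow> complex" assume a: "summable (\<lambda>n. (cmod (a n))\<^sup>2)"
    define A where "A = (\<Sum>n. (cmod (a n))\<^sup>2)"
    define B where "B = (\<Sum>n. (cmod (T a n))\<^sup>2)"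
    have summ: "summable (\<lambda>n. (cmod (T a n))\<^sup>2)"
      using upper[OF a]
      by (intro bounded_imp_summable[of _ A]) (simp_all add: A_def del: sum.lessThan_Suc flip: lessThan_Suc_atMost)
    have "B \<le> A"
      unfolding A_def B_def using upper[OF a] by (intro suminf_le_const summ)
    \<comment> \<open>The left side is the norm of \<open>T (trunc N a)\<close>. With
      \<open>trunc N a = a - ?b\<close>, Minkowski's inequality on \<open>{..<M}\<close> bounds it
      by the norms of \<open>T a\<close> and \<open>T ?b\<close>, and \<open>upper\<close> bounds
      the latter by the tail norm; then \<open>M\<close> tends to infinity.\<close>
    have "sqrt (\<Sum>n\<le>N. (cmod (a n))\<^sup>2) \<le> sqrt B + sqrt (A - (\<Sum>n\<le>N. (cmod (a n))\<^sup>2))" for N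
    proof (rule LIMSEQ_le_const2)
      show "(\<lambda>M. sqrt (\<Sum>n<M. (cmod (T (trunc N a) n))\<^sup>2)) \<longlonglongrightarrow> sqrt (\<Sum>n\<le>N. (cmod (a n))\<^sup>2)"
        using D'[of N a] by (intro tendsto_real_sqrt) (simp add: sums_def)
      let ?b = "\<lambda>n. a n - trunc N a n"
      have "(\<lambda>n. (cmod (a n))\<^sup>2 - (cmod (trunc N a n))\<^sup>2) sums (A - (\<Sum>n\<le>N. (cmod (trunc N a n))\<^sup>2))"
        unfolding A_def using a by (intro sums_diff summable_sums sums_finite) (auto simp: trunc_def)
      moreover have "(cmod (a n))\<^sup>2 - (cmod (trunc N a n))\<^sup>2 = (cmod (?b n))\<^sup>2" for n
        by (simp add: trunc_def)
      ultimately have b: "(\<lambda>n. (cmod (?b n))\<^sup>2) sums (A - (\<Sum>n\<le>N. (cmod (a n))\<^sup>2))"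
        by (simp add: trunc_def cong: if_cong)
      have "sqrt (\<Sum>n<M. (cmod (T (trunc N a) n))\<^sup>2) \<le> sqrt B + sqrt (A - (\<Sum>n\<le>N. (cmod (a n))\<^sup>2))" for M
      proof -
        have "cmod (T (trunc N a) n) \<le> cmod (T a n) + cmod (T ?b n)" for n
        proof -
          have "T (trunc N a) n = T a n - T ?b n"
            by (simp add: T_def left_diff_distrib sum_subtractf)
          then show ?thesis using norm_triangle_ineq4 by metis
        qed
        then have "L2_set (\<lambda>n. cmod (T (trunc N a) n)) {..<M}
            \<le> L2_set (\<lambda>n. cmod (T a n) + cmod (T ?b n)) {..<M}"
          by (intro L2_set_mono) auto
        also have "\<dots> \<le> L2_set (\<lambda>n. cmod (T a n)) {..<M} + L2_set (\<lambda>n. cmod (T ?b n)) {..<M}"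
          by (rule L2_set_triangle_ineq)
        also have "\<dots> \<le> sqrt B + sqrt (A - (\<Sum>n\<le>N. (cmod (a n))\<^sup>2))"
        proof (rule add_mono)
          show "L2_set (\<lambda>n. cmod (T a n)) {..<M} \<le> sqrt B"
            unfolding L2_set_def B_def by (intro real_sqrt_le_mono sum_le_suminf summ) auto
          show "L2_set (\<lambda>n. cmod (T ?b n)) {..<M} \<le> sqrt (A - (\<Sum>n\<le>N. (cmod (a n))\<^sup>2))"
            unfolding L2_set_def using upper[of ?b M] b by (intro real_sqrt_le_mono) (simp add: sums_iff)
        qed
        finally show ?thesis by (simp add: L2_set_def)
      qed
      then show "\<exists>K. \<forall>M\<ge>K. sqrt (\<Sum>n<M. (cmod (T (trunc N a) n))\<^sup>2) \<le> sqrt B + sqrt (A - (\<Sum>n\<le>N. (cmod (a n))\<^sup>2))"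
        by blast
    qed
    note bound = this
    have lim: "(\<lambda>N. \<Sum>n\<le>N. (cmod (a n))\<^sup>2) \<longlonglongrightarrow> A"
      unfolding A_def by (rule summable_LIMSEQ'[OF a])
    \<comment> \<open>As \<open>N\<close> grows the tail term tends to
      \<open>sqrt (A - A) = 0\<close>.\<close>
    have "sqrt A \<le> sqrt B + sqrt (A - A)"
    proof (rule LIMSEQ_le)
      show "(\<lambda>N. sqrt (\<Sum>n\<le>N. (cmod (a n))\<^sup>2)) \<longlonglongrightarrow> sqrt A"
        by (intro tendsto_real_sqrt lim)
      show "(\<lambda>N. sqrt B + sqrt (A - (\<Sum>n\<le>N. (cmod (a n))\<^sup>2))) \<longlonglongrightarrow> sqrt B + sqrt (A - A)"
        by (intro tendsto_add tendsto_real_sqrt tendsto_diff tendsto_const lim)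
    qed (use bound in blast)
    then have "A \<le> B" by simp
    with \<open>B \<le> A\<close> summ show "(\<lambda>n. (cmod (\<Sum>j\<le>n. a j * l (n - j)))\<^sup>2) sums (\<Sum>n. (cmod (a n))\<^sup>2)"
      unfolding A_def B_def T_def by (simp add: sums_iff)
  qed
qed

text \<open>If \<open>a\<close> vanishes beyond \<open>N\<close>, coefficients of index above
  \<open>N\<close> are sums over \<open>j \<le> N\<close> only. Splitting the series after index
  \<open>N\<close> and writing the later indices as \<open>N + 1 + m\<close> gives the shape of
  (d).\<close>

lemma finite_isometry_split_iff:
  fixes l :: "nat \<Rightarrow> complex"
  shows "(\<forall>N a. (\<forall>n>N. a n = 0) \<longrightarrow>
            (\<lambda>n. (cmod (\<Sum>j\<le>n. a j * l (n - j)))\<^sup>2) sums (\<Sum>n\<le>N. (cmod (a n))\<^sup>2))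
    \<longleftrightarrow> (\<forall>N a. summable (\<lambda>m. (cmod (\<Sum>j\<le>N. a j * l (N + 1 + m - j)))\<^sup>2) \<and>
            (\<Sum>n\<le>N. (cmod (\<Sum>j\<le>n. a j * l (n - j)))\<^sup>2)
              + (\<Sum>m. (cmod (\<Sum>j\<le>N. a j * l (N + 1 + m - j)))\<^sup>2)
            = (\<Sum>n\<le>N. (cmod (a n))\<^sup>2))"
  (is "?D \<longleftrightarrow> ?E")
proof -
  have *: "(\<lambda>n. (cmod (\<Sum>j\<le>n. a j * l (n - j)))\<^sup>2) sums R \<longleftrightarrow>
      summable (\<lambda>m. (cmod (\<Sum>j\<le>N. a j * l (N + 1 + m - j)))\<^sup>2) \<and>
        (\<Sum>n\<le>N. (cmod (\<Sum>j\<le>n. a j * l (n - j)))\<^sup>2)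
          + (\<Sum>m. (cmod (\<Sum>j\<le>N. a j * l (N + 1 + m - j)))\<^sup>2) = R"
    if "\<forall>n>N. a n = 0" for a N R
  proof -
    let ?t = "\<lambda>n. (cmod (\<Sum>j\<le>n. a j * l (n - j)))\<^sup>2"
    have "(\<Sum>j\<le>m + (N + 1). a j * l (m + (N + 1) - j)) = (\<Sum>j\<le>N. a j * l (N + 1 + m - j))" for m
      using that by (intro sum.mono_neutral_cong_right) (auto simp: add_ac)
    then have shift: "?t (m + (N + 1)) = (cmod (\<Sum>j\<le>N. a j * l (N + 1 + m - j)))\<^sup>2" for m
      by simp
    have "?t sums R \<longleftrightarrow> (\<lambda>m. ?t (m + (N + 1))) sums (R - (\<Sum>n<N + 1. ?t n))"
      by (rule sums_iff_shift'[symmetric])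
    also have "\<dots> \<longleftrightarrow> (\<lambda>m. (cmod (\<Sum>j\<le>N. a j * l (N + 1 + m - j)))\<^sup>2) sums (R - (\<Sum>n\<le>N. ?t n))"
      unfolding shift by (simp only: Suc_eq_plus1[symmetric] lessThan_Suc_atMost)
    finally show ?thesis by (auto simp: sums_iff)
  qed
  show ?thesis
  proof
    assume ?D
    show ?E
    proof (intro allI)
      fix N and a :: "nat \<Rightarrow> complex"
      \<comment> \<open>Here \<open>a\<close> carries no support condition, so its truncation is
        used; it agrees with \<open>a\<close> at every index that occurs in the claim.\<close>
      let ?b = "\<lambda>n. if n \<le> N then a n else 0"
      have "(\<lambda>n. (cmod (\<Sum>j\<le>n. ?b j * l (n - j)))\<^sup>2) sums (\<Sum>n\<le>N. (cmod (?b n))\<^sup>2)"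
        using \<open>?D\<close>[rule_format, of N ?b] by simp
      then have "summable (\<lambda>m. (cmod (\<Sum>j\<le>N. ?b j * l (N + 1 + m - j)))\<^sup>2) \<and>
        (\<Sum>n\<le>N. (cmod (\<Sum>j\<le>n. ?b j * l (n - j)))\<^sup>2)
          + (\<Sum>m. (cmod (\<Sum>j\<le>N. ?b j * l (N + 1 + m - j)))\<^sup>2) = (\<Sum>n\<le>N. (cmod (?b n))\<^sup>2)"
        by (subst (asm) *[of N]) auto
      moreover have "(\<Sum>j\<le>n. ?b j * l (n - j)) = (\<Sum>j\<le>n. a j * l (n - j))" if "n \<le> N" for n
        using that by (intro sum.cong) auto
      ultimately show "summable (\<lambda>m. (cmod (\<Sum>j\<le>N. a j * l (N + 1 + m - j)))\<^sup>2) \<and>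
            (\<Sum>n\<le>N. (cmod (\<Sum>j\<le>n. a j * l (n - j)))\<^sup>2)
              + (\<Sum>m. (cmod (\<Sum>j\<le>N. a j * l (N + 1 + m - j)))\<^sup>2)
            = (\<Sum>n\<le>N. (cmod (a n))\<^sup>2)"
        by simp
    qed
  qed (simp add: *)
qed

text \<open>The entries of \<open>a\<close> are the coefficients of a polynomial \<open>p\<close>,
  and the sum on the left is the limit of the squared means of \<open>\<phi> * p\<close>.
  Boundedness of \<open>\<phi>\<close> and \<open>p\<close> supplies the dominating constant
  \<open>C\<close>.\<close>

lemma inner_function_finite_isometry:
  fixes l :: "nat \<Rightarrow> complex"
  assumes inner: "inner_function \<phi>"
    and sums: "\<And>z. z \<in> ball 0 1 \<Longrightarrow> (\<lambda>n. l n * z ^ n) sums \<phi> z"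
    and a: "\<forall>n>N. a n = 0"
  shows "(\<lambda>n. (cmod (\<Sum>j\<le>n. a j * l (n - j)))\<^sup>2) sums (\<Sum>n\<le>N. (cmod (a n))\<^sup>2)"
proof -
  define p where "p z = (\<Sum>n<Suc N. a n * z ^ n)" for z
  define r where "r k = 1 - inverse (real (Suc k))" for k
  have r: "0 \<le> r k" "r k < 1" for k
    unfolding r_def by (rule radii_to_1)+
  have r_lim: "r \<longlonglongrightarrow> 1" and r_left: "filterlim r (at_left 1) sequentially"
    unfolding r_def by (rule radii_to_1)+
  have p_sums: "(\<lambda>n. a n * z ^ n) sums p z" for z
    unfolding p_def using a by (intro sums_finite) auto
  note prod_sums = power_series_mult_sums[OF p_sums sums]
  have hol: "\<phi> holomorphic_on ball 0 1" and le1: "\<And>z. z \<in> ball 0 1 \<Longrightarrow> cmod (\<phi> z) \<le> 1"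
    and bdry: "AE \<theta> in lebesgue_on {0..2*pi}.
        \<exists>w. ((\<lambda>r::real. \<phi> (of_real r * cis \<theta>)) \<longlongrightarrow> w) (at_left 1) \<and> cmod w = 1"
    using inner unfolding inner_function_def by auto
  define s where "s k \<theta> = (cmod (\<phi> (of_real (r k) * cis \<theta>) * p (of_real (r k) * cis \<theta>)))\<^sup>2" for k \<theta>
  have s_cont: "continuous_on {0..2*pi} (s k)" for k
  proof -
    have "continuous_on {0..2*pi} (\<lambda>\<theta>. \<phi> (of_real (r k) * cis \<theta>))"
      by (rule continuous_on_compose2[OF holomorphic_on_imp_continuous_on[OF hol]])
        (auto intro!: continuous_intros simp: norm_mult r)
    then show ?thesis
      unfolding s_def p_def by (intro continuous_intros)
  qed
  define C where "C = (\<Sum>n<Suc N. cmod (a n))\<^sup>2"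
  have p_bound: "cmod (p z) \<le> (\<Sum>n<Suc N. cmod (a n))" if "cmod z \<le> 1" for z
    unfolding p_def using that
    by (intro order_trans[OF norm_sum] sum_mono) (auto simp: norm_mult norm_power intro!: mult_left_le power_le_one)
  have "(\<lambda>k. integral\<^sup>L (lebesgue_on {0..2*pi}) (s k)) \<longlonglongrightarrow> integral\<^sup>L (lebesgue_on {0..2*pi}) (\<lambda>\<theta>. (cmod (p (cis \<theta>)))\<^sup>2)"
  proof (rule integral_dominated_convergence)
    show "(\<lambda>\<theta>. (cmod (p (cis \<theta>)))\<^sup>2) \<in> borel_measurable (lebesgue_on {0..2*pi})"
      unfolding p_def
      by (intro continuous_imp_measurable_on_sets_lebesgue continuous_intros) auto
    show "s k \<in> borel_measurable (lebesgue_on {0..2*pi})" for k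
    proof (rule continuous_imp_measurable_on_sets_lebesgue)
      show "continuous_on {0..2*pi} (s k)" by (rule s_cont)
    qed simp
    show "integrable (lebesgue_on {0..2*pi}) (\<lambda>\<theta>. C)"
      by (intro continuous_imp_integrable_real continuous_intros)
    show "AE \<theta> in lebesgue_on {0..2*pi}. norm (s k \<theta>) \<le> C" for k
    proof (rule AE_I2)
      fix \<theta>
      have "cmod (\<phi> (of_real (r k) * cis \<theta>)) * cmod (p (of_real (r k) * cis \<theta>)) \<le> 1 * (\<Sum>n<Suc N. cmod (a n))"
        using r[of k] by (intro mult_mono le1 p_bound) (auto simp: norm_mult)
      then show "norm (s k \<theta>) \<le> C"
        unfolding s_def C_def by (simp add: norm_mult power_mono del: sum.lessThan_Suc)
    qed
    show "AE \<theta> in lebesgue_on {0..2*pi}. (\<lambda>k. s k \<theta>) \<longlonglongrightarrow> (cmod (p (cis \<theta>)))\<^sup>2"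
      using bdry
    proof eventually_elim
      fix \<theta> assume "\<exists>w. ((\<lambda>r::real. \<phi> (of_real r * cis \<theta>)) \<longlongrightarrow> w) (at_left 1) \<and> cmod w = 1"
      then obtain w where w: "((\<lambda>r::real. \<phi> (of_real r * cis \<theta>)) \<longlongrightarrow> w) (at_left 1)" "cmod w = 1" by blast
      \<comment> \<open>The radial limit \<open>w\<close> of \<open>\<phi>\<close> is unimodular and
        drops out of the limit.\<close>
      have "(\<lambda>k. s k \<theta>) \<longlonglongrightarrow> (cmod (w * p (of_real 1 * cis \<theta>)))\<^sup>2"
        unfolding s_def p_def by (intro tendsto_intros r_lim filterlim_compose[OF w(1) r_left])
      then show "(\<lambda>k. s k \<theta>) \<longlonglongrightarrow> (cmod (p (cis \<theta>)))\<^sup>2" using w(2) by (simp add: norm_mult)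
    qed
  qed
  moreover have "integral\<^sup>L (lebesgue_on {0..2*pi}) (s k) = 2 * pi * (hardy_mean (\<lambda>z. \<phi> z * p z) (r k))\<^sup>2" for k
  proof -
    have "(s k has_integral 2 * pi * (hardy_mean (\<lambda>z. \<phi> z * p z) (r k))\<^sup>2) {0..2*pi}"
      unfolding s_def by (rule hardy_mean_parseval(2)[OF prod_sums r])
    then show ?thesis
      using lebesgue_integral_eq_integral[OF continuous_imp_integrable_real[OF s_cont]]
      by (simp add: integral_unique)
  qed
  moreover have "integral\<^sup>L (lebesgue_on {0..2*pi}) (\<lambda>\<theta>. (cmod (p (cis \<theta>)))\<^sup>2) = 2 * pi * (\<Sum>n\<le>N. (cmod (a n))\<^sup>2)"
  proof -
    have "integrable (lebesgue_on {0..2*pi}) (\<lambda>\<theta>. (cmod (p (cis \<theta>)))\<^sup>2)"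
      unfolding p_def by (intro continuous_imp_integrable_real continuous_intros)
    moreover have "p (cis \<theta>) = (\<Sum>n<Suc N. a n * cis (real n * \<theta>))" for \<theta>
      by (simp add: p_def Complex.DeMoivre)
    ultimately show ?thesis
      using has_integral_cmod_trig_poly[of a "Suc N"]
      by (simp add: lebesgue_integral_eq_integral integral_unique lessThan_Suc_atMost del: sum.lessThan_Suc)
  qed
  ultimately have "(\<lambda>k. 2 * pi * (hardy_mean (\<lambda>z. \<phi> z * p z) (r k))\<^sup>2) \<longlonglongrightarrow> 2 * pi * (\<Sum>n\<le>N. (cmod (a n))\<^sup>2)"
    by simp
  from tendsto_divide[OF this tendsto_const[of "2 * pi"]]
  have "(\<lambda>k. (hardy_mean (\<lambda>z. \<phi> z * p z) (r k))\<^sup>2) \<longlonglongrightarrow> (\<Sum>n\<le>N. (cmod (a n))\<^sup>2)"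
    by simp
  from sums_cmod_square_coeffs[OF prod_sums r r_lim this] show ?thesis .
qed

section \<open>Radial limits from boundary derivatives\<close>

text \<open>Taking \<open>m\<close>-th roots would wash out the constants: if \<open>x > y\<close>,
  the powers of \<open>x / y\<close> would eventually exceed \<open>B / c\<close>. Used both in a
  maximum principle and to bound an isometric multiplier by 1.\<close>

lemma le_of_power_le:
  fixes x y :: real
  assumes "0 \<le> x" "0 < y" "0 < c" and le: "\<And>m. x ^ m * c \<le> B * y ^ m"
  shows "x \<le> y"
proof (rule ccontr)
  assume "\<not> x \<le> y"
  then have "1 < x / y" using \<open>0 < y\<close> by simp
  then obtain m where m: "B / c < (x / y) ^ m" using real_arch_pow by blast
  have "B * y ^ m < x ^ m * c"
    using m \<open>0 < y\<close> \<open>0 < c\<close> by (simp add: power_divide field_simps)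
  then show False using le[of m] by simp
qed

text \<open>
  The peak function \<open>p z = (1 + z * cnj w) / 2\<close> suppresses the
  boundary values of \<open>Q = K / (z - w)\<close> away from \<open>w\<close>; the single point \<open>w\<close>, where \<open>Q\<close> need not extend
  continuously, is neutralised by applying the maximum principle to \<open>(p ^ n * Q) ^ m * (z - w)\<close> and
  letting \<open>m\<close> tend to infinity.
\<close>

lemma small_at_boundary_point:
  fixes K :: "complex \<Rightarrow> complex"
  assumes cont: "continuous_on (cball 0 1) K" and hol: "K holomorphic_on ball 0 1"
    and w: "cmod w = 1"
    and M: "\<And>z. z \<in> cball 0 1 \<Longrightarrow> cmod (K z) \<le> M * cmod (z - w)"
    and bdry: "\<And>e. e > 0 \<Longrightarrow> \<exists>d>0. \<forall>z. cmod z = 1 \<and> cmod (z - w) < d \<longrightarrow> cmod (K z) \<le> e * cmod (z - w)"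
    and e: "e > 0"
  shows "\<exists>d>0. \<forall>z\<in>ball 0 1. cmod (z - w) < d \<longrightarrow> cmod (K z) \<le> e * cmod (z - w)"
proof -
  define p where "p z = (1 + z * cnj w) / 2" for z
  have wcw: "w * cnj w = 1" using complex_norm_square[of w] w by simp
  have p_w: "p w = 1" by (simp add: p_def wcw)
  \<comment> \<open>The hypothesis \<open>M\<close> is tested at \<open>- w\<close>, which lies at
    distance 2 from \<open>w\<close>.\<close>
  have M0: "0 \<le> M"
  proof -
    have "cmod (- w - w) = 2" using w norm_mult[of "-2" w] by simp
    then show ?thesis using order_trans[OF norm_ge_zero M[of "- w"]] w by simp
  qed
  obtain \<delta> where \<delta>: "\<delta> > 0" "\<And>z. cmod z = 1 \<Longrightarrow> cmod (z - w) < \<delta> \<Longrightarrow> cmod (K z) \<le> e / 2 * cmod (z - w)"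
    using bdry[of "e / 2"] e by auto
  \<comment> \<open>By \<open>p_eq\<close> below, \<open>q\<close> bounds \<open>p\<close> on the
    part of the circle at distance at least \<open>\<delta>\<close> from \<open>w\<close>;
    \<open>max 0\<close> covers \<open>\<delta> > 2\<close>, where the difference is
    negative.\<close>
  define q where "q = sqrt (max 0 (1 - \<delta>\<^sup>2 / 4))"
  have q: "0 \<le> q" "q < 1" using \<delta>(1) by (auto simp: q_def)
  \<comment> \<open>Multiplying by the unimodular \<open>w\<close> gives
    \<open>cmod (p z) = cmod (w + z) / 2\<close>; the parallelogram law does the rest.\<close>
  have p_eq: "(cmod (p z))\<^sup>2 = 1 - (cmod (z - w))\<^sup>2 / 4" if "cmod z = 1" for z
  proof -
    have "cmod (p z) = cmod (w * (1 + z * cnj w)) / 2" using w by (simp add: p_def norm_mult)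
    also have "w * (1 + z * cnj w) = w + z" using wcw by (simp add: ring_distribs mult_ac)
    finally have "cmod (p z) = cmod (w + z) / 2" .
    then have "(cmod (p z))\<^sup>2 = (cmod (w + z))\<^sup>2 / 4" by (simp only: power_divide) simp
    moreover have "(cmod (w + z))\<^sup>2 + (cmod (z - w))\<^sup>2 = 4"
    proof -
      have "(cmod (w + z))\<^sup>2 + (cmod (z - w))\<^sup>2 = 2 * (cmod z)\<^sup>2 + 2 * (cmod w)\<^sup>2"
        by (simp add: power2_norm_eq_inner inner_simps inner_commute)
      then show ?thesis using that w by simp
    qed
    ultimately show ?thesis by simp
  qed
  have p_le: "cmod (p z) \<le> 1" if "cmod z \<le> 1" for z
    using that w norm_triangle_ineq[of 1 "z * cnj w"] by (simp add: p_def norm_mult)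
  have p_q: "cmod (p z) \<le> q" if "cmod z = 1" "\<delta> \<le> cmod (z - w)" for z
  proof -
    have "(cmod (p z))\<^sup>2 \<le> max 0 (1 - \<delta>\<^sup>2 / 4)"
      using p_eq[OF that(1)] power_mono[OF that(2), of 2] \<delta>(1) by (simp add: le_max_iff_disj)
    then show ?thesis unfolding q_def by (rule real_le_rsqrt)
  qed
  \<comment> \<open>A large power of \<open>p\<close> brings the crude bound \<open>M\<close> below
    \<open>e / 2\<close> on the far arc.\<close>
  have "(\<lambda>n. M * q ^ n) \<longlonglongrightarrow> M * 0" using q by (intro tendsto_mult tendsto_const LIMSEQ_power_zero) simp
  then have "eventually (\<lambda>n. M * q ^ n < e / 2) sequentially" using e by (intro order_tendstoD(2)) auto
  then obtain n where n: "M * q ^ n < e / 2" by (auto simp: eventually_sequentially)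
  \<comment> \<open>Division by zero gives \<open>Q w = 0\<close>, so the bounds below hold at
    \<open>w\<close> too.\<close>
  define Q where "Q z = p z ^ n * (K z / (z - w))" for z
  have Q_M: "cmod (Q z) \<le> M" if "cmod z \<le> 1" for z
  proof (cases "z = w")
    case False
    then have "cmod (K z / (z - w)) \<le> M" using M[of z] that by (simp add: norm_divide field_simps)
    then have "cmod (p z) ^ n * cmod (K z / (z - w)) \<le> 1 * M"
      using p_le[OF that] by (intro mult_mono power_le_one) auto
    then show ?thesis by (simp add: Q_def norm_mult norm_power del: times_divide_eq_right)
  qed (simp add: Q_def M0)
  have Q_bdry: "cmod (Q z) \<le> e / 2" if "cmod z = 1" for z
  proof (cases "cmod (z - w) < \<delta>")
    case True
    then have "cmod (K z / (z - w)) \<le> e / 2"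
      using \<delta>(2)[OF that True] e by (cases "z = w") (simp_all add: norm_divide field_simps)
    then have "cmod (p z) ^ n * cmod (K z / (z - w)) \<le> 1 * (e / 2)"
      using p_le[of z] that by (intro mult_mono power_le_one) auto
    then show ?thesis by (simp add: Q_def norm_mult norm_power del: times_divide_eq_right)
  next
    case False
    then have "cmod (K z / (z - w)) \<le> M" using M[of z] that \<delta>(1) by (cases "z = w") (simp_all add: norm_divide field_simps)
    then have "cmod (p z) ^ n * cmod (K z / (z - w)) \<le> q ^ n * M"
      using p_q[OF that] False q by (intro mult_mono power_mono) auto
    then show ?thesis using n by (simp add: Q_def norm_mult norm_power mult.commute[of _ M] del: times_divide_eq_right)
  qed
  \<comment> \<open>The constant 2 bounds \<open>cmod (z - w)\<close> on the unit circle;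
    \<open>le_of_power_le\<close> removes it together with the factor \<open>z - w\<close>.\<close>
  have Q_in: "cmod (Q z) \<le> e / 2" if z: "z \<in> ball 0 1" for z
  proof (rule le_of_power_le[where c = "cmod (z - w)" and B = 2])
    show "0 < cmod (z - w)" using z w by auto
    fix m
    let ?F = "\<lambda>z. Q z ^ m * (z - w)"
    have "cmod (?F z) \<le> 2 * (e / 2) ^ m"
    proof (rule maximum_modulus_frontier[of ?F "ball 0 1"])
      have "?F holomorphic_on ball 0 1"
        unfolding Q_def p_def using w by (intro holomorphic_intros hol) auto
      then show "?F holomorphic_on interior (ball 0 1)" by simp
      have "continuous_on (cball 0 1) ?F"
        unfolding continuous_on_eq_continuous_within
      proof
        fix x :: complex assume x: "x \<in> cball 0 1"
        show "continuous (at x within cball 0 1) ?F"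
        proof (cases "x = w")
          case False
          have "continuous (at x within cball 0 1) K"
            using cont x continuous_on_eq_continuous_within by blast
          then show ?thesis unfolding Q_def p_def using False by (intro continuous_intros) auto
        next
          case True
          \<comment> \<open>At \<open>w\<close> the factor \<open>z - w\<close> forces the limit 0,
            since \<open>Q\<close> is bounded by \<open>M\<close>.\<close>
          have "((\<lambda>z. M ^ m * cmod (z - w)) \<longlongrightarrow> M ^ m * cmod (w - w)) (at w within cball 0 1)"
            by (intro tendsto_intros)
          then have lim: "((\<lambda>z. M ^ m * cmod (z - w)) \<longlongrightarrow> 0) (at w within cball 0 1)" by simp
          have "cmod (?F z) \<le> M ^ m * cmod (z - w)" if "z \<in> cball 0 1" for z
            unfolding norm_mult norm_power using that by (intro mult_right_mono power_mono Q_M) auto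
          then have "eventually (\<lambda>z. cmod (?F z) \<le> M ^ m * cmod (z - w)) (at w within cball 0 1)"
            unfolding eventually_at_filter by (intro always_eventually allI impI)
          then have "(?F \<longlongrightarrow> 0) (at w within cball 0 1)"
            using lim by (rule Lim_null_comparison)
          then show ?thesis using True by (simp add: continuous_within)
        qed
      qed
      then show "continuous_on (closure (ball 0 1)) ?F" by simp
      show "cmod (?F z) \<le> 2 * (e / 2) ^ m" if "z \<in> frontier (ball 0 1)" for z
      proof -
        have "cmod z = 1" using that by (simp add: dist_norm)
        then have "cmod (Q z) ^ m * cmod (z - w) \<le> (e / 2) ^ m * 2"
          using Q_bdry[of z] norm_triangle_ineq4[of z w] w e by (intro mult_mono power_mono) auto
        then show ?thesis by (simp add: norm_mult norm_power)
      qed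
    qed (use z in auto)
    then show "cmod (Q z) ^ m * cmod (z - w) \<le> 2 * (e / 2) ^ m" by (simp add: norm_mult norm_power)
  qed (use e in auto)
  \<comment> \<open>Near \<open>w\<close> the factor \<open>p z ^ n\<close> has modulus above 1/2,
    so removing it from \<open>Q\<close> at most doubles the bound \<open>e / 2\<close>.\<close>
  have "((\<lambda>z. cmod (p z) ^ n) \<longlongrightarrow> cmod (p w) ^ n) (at w)"
    unfolding p_def by (intro tendsto_intros) auto
  then have "eventually (\<lambda>z. 1 / 2 < cmod (p z) ^ n) (at w)"
    by (rule order_tendstoD(1)) (simp add: p_w)
  then obtain d where d: "d > 0" "\<And>z. z \<noteq> w \<Longrightarrow> dist z w < d \<Longrightarrow> 1 / 2 < cmod (p z) ^ n"
    unfolding eventually_at by auto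
  show ?thesis
  proof (intro exI conjI ballI impI)
    fix z assume z: "z \<in> ball 0 1" "cmod (z - w) < d"
    then have "z \<noteq> w" using w by auto
    have "1 / 2 * (cmod (K z) / cmod (z - w)) \<le> cmod (p z) ^ n * (cmod (K z) / cmod (z - w))"
      using d(2)[OF \<open>z \<noteq> w\<close>] z(2) by (intro mult_right_mono) (auto simp: dist_norm)
    also have "\<dots> \<le> e / 2" using Q_in[OF z(1)] by (simp add: Q_def norm_mult norm_power norm_divide del: times_divide_eq_right)
    finally show "cmod (K z) \<le> e * cmod (z - w)" using \<open>z \<noteq> w\<close> by (simp add: field_simps)
  qed (fact d(1))
qed

text \<open>Subtracting the affine function with slope \<open>c\<close> leaves \<open>K\<close>,
  with derivative \<open>\<phi> z - c\<close>. Smallness of \<open>K\<close> on the circle near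
  \<open>w\<close> spreads into the disk by \<open>small_at_boundary_point\<close>, and Cauchy's
  estimate transfers it to the derivative.\<close>

lemma radial_limit_of_boundary_derivative:
  fixes G \<phi> :: "complex \<Rightarrow> complex"
  assumes lip: "M-lipschitz_on (cball 0 1) G"
    and deriv: "\<And>z. z \<in> ball 0 1 \<Longrightarrow> (G has_field_derivative \<phi> z) (at z)"
    and w: "cmod w = 1"
    and bdry: "\<And>e. e > 0 \<Longrightarrow> \<exists>d>0. \<forall>z. cmod z = 1 \<and> cmod (z - w) < d \<longrightarrow>
                  cmod (G z - G w - c * (z - w)) \<le> e * cmod (z - w)"
  shows "((\<lambda>r. \<phi> (of_real r * w)) \<longlongrightarrow> c) (at_left 1)"
proof -
  define K where "K z = G z - G w - c * (z - w)" for z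
  have holG: "G holomorphic_on ball 0 1"
    using deriv by (auto simp: holomorphic_on_open intro!: exI)
  have cont: "continuous_on (cball 0 1) K"
    unfolding K_def by (intro continuous_intros lipschitz_on_continuous_on[OF lip])
  have hol: "K holomorphic_on ball 0 1"
    unfolding K_def by (intro holomorphic_intros holG)
  have K_M: "cmod (K z) \<le> (M + cmod c) * cmod (z - w)" if "z \<in> cball 0 1" for z
  proof -
    have "cmod (K z) \<le> cmod (G z - G w) + cmod (c * (z - w))"
      unfolding K_def by (rule norm_triangle_ineq4)
    then show ?thesis
      using lipschitz_onD[OF lip that, of w] w by (simp add: dist_norm norm_mult distrib_right)
  qed
  have dK: "(K has_field_derivative \<phi> z - c) (at z)" if "z \<in> ball 0 1" for z
    unfolding K_def by (rule derivative_eq_intros deriv that refl | simp)+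
  show ?thesis
  proof (rule tendstoI)
    fix e :: real assume e: "e > 0"
    \<comment> \<open>Points of the circle of radius \<open>s = (1 - r) / 2\<close> about
      \<open>r * w\<close> are within \<open>3 * s\<close> of \<open>w\<close>, so
      \<open>e / 6\<close> yields \<open>e / 2\<close> after dividing by \<open>s\<close>.\<close>
    obtain d where d: "d > 0" "\<And>z. z \<in> ball 0 1 \<Longrightarrow> cmod (z - w) < d \<Longrightarrow> cmod (K z) \<le> e / 6 * cmod (z - w)"
      using small_at_boundary_point[OF cont hol w K_M bdry[folded K_def], of "e / 6"] e by auto
    \<comment> \<open>For such \<open>r\<close>, \<open>3 * s\<close> is below
      \<open>3 * d / 4\<close>, hence below \<open>d\<close>.\<close>
    have "eventually (\<lambda>r. r \<in> {max 0 (1 - d / 2)<..<1}) (at_left (1::real))"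
      using d(1) by (intro eventually_at_left_real) auto
    then show "eventually (\<lambda>r. dist (\<phi> (of_real r * w)) c < e) (at_left 1)"
    proof eventually_elim
      fix r :: real assume r: "r \<in> {max 0 (1 - d / 2)<..<1}"
      define s where "s = (1 - r) / 2"
      have s: "s > 0" using r by (simp add: s_def)
      let ?z = "of_real r * w"
      have nz: "cmod ?z = r" "cmod (?z - w) = 1 - r"
      proof -
        show "cmod ?z = r" using r w by (simp add: norm_mult)
        have "?z - w = of_real (r - 1) * w" by (simp add: algebra_simps)
        then show "cmod (?z - w) = 1 - r" using r w by (simp only: norm_mult norm_of_real) simp
      qed
      have sub: "cball ?z s \<subseteq> ball 0 1"
      proof
        fix x assume "x \<in> cball ?z s"
        then have "cmod (x - ?z) \<le> s" by (simp add: dist_norm norm_minus_commute)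
        then show "x \<in> ball 0 1" using nz(1) norm_triangle_sub[of x ?z] r by (simp add: s_def)
      qed
      have "norm ((deriv ^^ 1) K ?z) \<le> fact 1 * (e / 6 * (3 * s)) / s ^ 1"
      proof (rule Cauchy_inequality)
        show "K holomorphic_on ball ?z s"
          using hol sub by (meson ball_subset_cball holomorphic_on_subset order_trans)
        show "continuous_on (cball ?z s) K"
          using holomorphic_on_imp_continuous_on[OF hol] sub continuous_on_subset by blast
        fix x assume x: "norm (?z - x) = s"
        then have xb: "x \<in> ball 0 1" using sub by (auto simp: dist_norm)
        have le: "cmod (x - w) \<le> 3 * s"
          using norm_triangle_ineq[of "x - ?z" "?z - w"] x nz(2) by (simp add: s_def norm_minus_commute)
        then have "cmod (x - w) < d" using r by (simp add: s_def)
        from d(2)[OF xb this] have "cmod (K x) \<le> e / 6 * cmod (x - w)" .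
        also have "\<dots> \<le> e / 6 * (3 * s)" using le e by (intro mult_left_mono) auto
        finally show "norm (K x) \<le> e / 6 * (3 * s)" .
      qed (fact s)
      moreover have "deriv K ?z = \<phi> ?z - c"
        using nz(1) r by (intro DERIV_imp_deriv dK) auto
      ultimately have "cmod (\<phi> ?z - c) \<le> e / 2" using s by simp
      then show "dist (\<phi> (of_real r * w)) c < e" using e by (simp add: dist_norm)
    qed
  qed
qed

text \<open>Converts differentiability in the angle into the estimate in \<open>z\<close> that
  \<open>radial_limit_of_boundary_derivative\<close> asks for. The factor
  \<open>\<i> * cis \<theta>\<^sub>0\<close> is the derivative of \<open>cis\<close>, so
  \<open>c\<close> acts as the derivative of \<open>G\<close> along the circle.\<close>

lemma circle_derivative_imp_boundary:
  fixes G :: "complex \<Rightarrow> complex"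
  assumes deriv: "((\<lambda>\<theta>. G (cis \<theta>)) has_vector_derivative \<i> * cis \<theta>\<^sub>0 * c) (at \<theta>\<^sub>0)" and e: "e > 0"
  shows "\<exists>d>0. \<forall>z. cmod z = 1 \<and> cmod (z - cis \<theta>\<^sub>0) < d \<longrightarrow>
            cmod (G z - G (cis \<theta>\<^sub>0) - c * (z - cis \<theta>\<^sub>0)) \<le> e * cmod (z - cis \<theta>\<^sub>0)"
proof -
  define w where "w = cis \<theta>\<^sub>0"
  have w: "cmod w = 1" "w \<noteq> 0" by (auto simp: w_def)
  define \<psi> where "\<psi> \<theta> = G (cis \<theta>) - G w - c * (cis \<theta> - w)" for \<theta>
  have cis_deriv: "(cis has_vector_derivative \<i> * w) (at \<theta>\<^sub>0)"
    unfolding w_def cis_conv_exp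
    by (auto intro!: derivative_eq_intros has_vector_derivative_real_field)
  have "(\<psi> has_vector_derivative (\<i> * w * c - 0) - c * (\<i> * w - 0)) (at \<theta>\<^sub>0)"
    unfolding \<psi>_def
    by (intro has_vector_derivative_diff has_vector_derivative_mult_right has_vector_derivative_const
        deriv[folded w_def] cis_deriv)
  then have \<psi>_deriv: "(\<psi> has_derivative (\<lambda>h. 0)) (at \<theta>\<^sub>0)"
    by (simp add: has_vector_derivative_def)
  obtain d1 where d1: "d1 > 0"
    "\<And>\<theta>. \<bar>\<theta> - \<theta>\<^sub>0\<bar> < d1 \<Longrightarrow> cmod (\<psi> \<theta>) \<le> e / 2 * \<bar>\<theta> - \<theta>\<^sub>0\<bar>"
  proof -
    have "\<psi> \<theta>\<^sub>0 = 0" by (simp add: \<psi>_def w_def)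
    moreover have "\<exists>d>0. \<forall>\<theta>. norm (\<theta> - \<theta>\<^sub>0) < d \<longrightarrow> norm (\<psi> \<theta> - \<psi> \<theta>\<^sub>0 - 0) \<le> e / 2 * norm (\<theta> - \<theta>\<^sub>0)"
      using \<psi>_deriv[unfolded has_derivative_at_alt] e by (meson half_gt_zero)
    ultimately show ?thesis using that by auto
  qed
  \<comment> \<open>Since \<open>cis\<close> has a derivative of modulus 1, the angle is at most
    twice the chord near \<open>\<theta>\<^sub>0\<close>.\<close>
  obtain d2 where d2: "d2 > 0"
    "\<And>\<theta>. \<bar>\<theta> - \<theta>\<^sub>0\<bar> < d2 \<Longrightarrow> \<bar>\<theta> - \<theta>\<^sub>0\<bar> \<le> 2 * cmod (cis \<theta> - w)"
  proof -
    have "\<exists>d>0. \<forall>\<theta>. norm (\<theta> - \<theta>\<^sub>0) < d \<longrightarrow>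
        norm (cis \<theta> - cis \<theta>\<^sub>0 - (\<theta> - \<theta>\<^sub>0) *\<^sub>R (\<i> * w)) \<le> 1 / 2 * norm (\<theta> - \<theta>\<^sub>0)"
      using cis_deriv[unfolded has_vector_derivative_def has_derivative_at_alt]
      by (meson half_gt_zero zero_less_one)
    then obtain d where d: "d > 0" and le: "\<And>\<theta>. \<bar>\<theta> - \<theta>\<^sub>0\<bar> < d \<Longrightarrow>
        norm (cis \<theta> - w - (\<theta> - \<theta>\<^sub>0) *\<^sub>R (\<i> * w)) \<le> 1 / 2 * \<bar>\<theta> - \<theta>\<^sub>0\<bar>"
      by (auto simp: w_def)
    have "\<bar>\<theta> - \<theta>\<^sub>0\<bar> \<le> 2 * cmod (cis \<theta> - w)" if "\<bar>\<theta> - \<theta>\<^sub>0\<bar> < d" for \<theta>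
    proof -
      have "norm ((\<theta> - \<theta>\<^sub>0) *\<^sub>R (\<i> * w)) = \<bar>\<theta> - \<theta>\<^sub>0\<bar>"
        using w norm_mult[of \<i> w] by (simp only: norm_scaleR) simp
      moreover have "norm ((\<theta> - \<theta>\<^sub>0) *\<^sub>R (\<i> * w))
          \<le> cmod (cis \<theta> - w) + norm (cis \<theta> - w - (\<theta> - \<theta>\<^sub>0) *\<^sub>R (\<i> * w))"
        using norm_triangle_sub[of "(\<theta> - \<theta>\<^sub>0) *\<^sub>R (\<i> * w)" "cis \<theta> - w"] by (simp only: norm_minus_commute)
      moreover have "x \<le> 2 * y" if "x \<le> y + v" "v \<le> 1 / 2 * x" for x y v :: real
        using that by simp
      ultimately show ?thesis using le[OF that] by metis
    qed
    with d that show ?thesis by blast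
  qed
  \<comment> \<open>Dividing by \<open>w\<close> moves the base point to 1, off the branch cut of
    \<open>Arg\<close>, so that \<open>z\<close> near \<open>w\<close> has an angle near
    \<open>\<theta>\<^sub>0\<close>.\<close>
  have "isCont Arg 1" by (rule continuous_at_Arg) simp
  then have "isCont (\<lambda>z. Arg (z / w)) w"
    using w by (intro isCont_o2[of w "\<lambda>z. z / w" Arg] continuous_intros) auto
  then obtain d where d: "d > 0" "\<And>z. dist z w < d \<Longrightarrow> dist (Arg (z / w)) (Arg (w / w)) < min d1 d2"
    using d1(1) d2(1) unfolding continuous_at_eps_delta by (metis min_less_iff_conj)
  show ?thesis
  proof (intro exI conjI allI impI)
    fix z assume z: "cmod z = 1 \<and> cmod (z - cis \<theta>\<^sub>0) < d"
    define \<theta> where "\<theta> = \<theta>\<^sub>0 + Arg (z / w)"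
    have zw: "cis (Arg (z / w)) = z / w"
    proof -
      have "z \<noteq> 0" using z by auto
      then show ?thesis using z w Arg_eq[of "z / w"] by (simp add: norm_divide cis_conv_exp)
    qed
    have z_eq: "z = cis \<theta>"
      using zw w(2) by (simp add: \<theta>_def w_def flip: cis_mult)
    have small: "\<bar>\<theta> - \<theta>\<^sub>0\<bar> < min d1 d2"
      using d(2)[of z] z w(2) by (simp add: \<theta>_def dist_norm w_def)
    have "cmod (\<psi> \<theta>) \<le> e / 2 * \<bar>\<theta> - \<theta>\<^sub>0\<bar>" using d1(2) small by simp
    also have "\<dots> \<le> e / 2 * (2 * cmod (cis \<theta> - w))" using d2(2)[of \<theta>] small e by (intro mult_left_mono) auto
    finally show "cmod (G z - G (cis \<theta>\<^sub>0) - c * (z - cis \<theta>\<^sub>0)) \<le> e * cmod (z - cis \<theta>\<^sub>0)"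
      by (simp add: \<psi>_def z_eq w_def)
  qed (fact d(1))
qed

text \<open>Lebesgue differentiation. \<open>integrable_ccontinuous_explicit\<close> controls
  averages over intervals to the right of a point; applied to the reflected function as well, it
  gives both one-sided derivatives off a negligible set.\<close>

lemma indefinite_integral_has_vector_derivative_ae:
  fixes h :: "real \<Rightarrow> 'b::euclidean_space"
  assumes h: "h integrable_on {a..b}"
  obtains N where "negligible N"
    "\<And>x. x \<in> {a<..<b} - N \<Longrightarrow> ((\<lambda>u. integral {a..u} h) has_vector_derivative h x) (at x)"
proof -
  \<comment> \<open>Extension by zero makes the function integrable on every bounded interval,
    including those leaving \<open>{a..b}\<close>.\<close>
  define h0 where "h0 x = (if x \<in> {a..b} then h x else 0)" for x
  have h0: "h0 integrable_on {u..v}" for u v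
    unfolding h0_def by (rule integrable_altD(1)[of h "{a..b}", unfolded cbox_interval]) (use h in auto)
  have h0': "(\<lambda>x. h0 (- x)) integrable_on {u..v}" for u v
    using Henstock_Kurzweil_Integration.integrable_reflect_real[where f=h0 and a="- v" and b="- u"] h0[of "- v" "- u"] by simp
  obtain N1 where N1: "negligible N1" and right: "\<And>x e. x \<notin> N1 \<Longrightarrow> 0 < e \<Longrightarrow>
      \<exists>d>0. \<forall>t. 0 < t \<and> t < d \<longrightarrow> norm (integral {x..x + t} h0 /\<^sub>R t - h0 x) < e"
    using integrable_ccontinuous_explicit[of h0] h0 by auto
  obtain N2 where N2: "negligible N2" and left': "\<And>x e. x \<notin> N2 \<Longrightarrow> 0 < e \<Longrightarrow>
      \<exists>d>0. \<forall>t. 0 < t \<and> t < d \<longrightarrow> norm (integral {x..x + t} (\<lambda>x. h0 (- x)) /\<^sub>R t - h0 (- x)) < e"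
    using integrable_ccontinuous_explicit[of "\<lambda>x. h0 (- x)"] h0' by auto
  have left: "\<exists>d>0. \<forall>t. 0 < t \<and> t < d \<longrightarrow> norm (integral {x - t..x} h0 /\<^sub>R t - h0 x) < e"
    if "x \<notin> uminus ` N2" "0 < e" for x e
  proof -
    have "- x \<notin> N2" using that(1) by (metis image_eqI minus_minus)
    moreover have "integral {- x..- x + t} (\<lambda>x. h0 (- x)) = integral {x - t..x} h0" for t
      using Henstock_Kurzweil_Integration.integral_reflect_real[where f=h0 and a="x - t" and b=x] by simp
    ultimately show ?thesis using left'[of "- x" e] that(2) by simp
  qed
  show ?thesis
  proof (rule that[of "N1 \<union> uminus ` N2"])
    have "negligible (uminus ` N2)"
      using N2 by (intro negligible_differentiable_image_negligible differentiable_on_minus differentiable_on_id) auto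
    then show "negligible (N1 \<union> uminus ` N2)" using N1 by simp
    fix x assume x: "x \<in> {a<..<b} - (N1 \<union> uminus ` N2)"
    have h0_x: "h0 x = h x" using x by (simp add: h0_def)
    have comb: "integral {a..u} h0 + integral {u..v} h0 = integral {a..v} h0" if "a \<le> u" "u \<le> v" for u v
      using that h0 by (intro Henstock_Kurzweil_Integration.integral_combine) auto
    have "((\<lambda>u. integral {a..u} h0) has_derivative (\<lambda>t. t *\<^sub>R h x)) (at x)"
      unfolding has_derivative_at_alt
    proof (intro conjI allI impI)
      show "bounded_linear (\<lambda>t. t *\<^sub>R h x)" by (rule bounded_linear_scaleR_left)
      fix e :: real assume e: "e > 0"
      obtain d1 where d1: "d1 > 0" "\<And>t. 0 < t \<Longrightarrow> t < d1 \<Longrightarrow> norm (integral {x..x + t} h0 /\<^sub>R t - h x) < e"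
        using right[of x e] x e h0_x by auto
      obtain d2 where d2: "d2 > 0" "\<And>t. 0 < t \<Longrightarrow> t < d2 \<Longrightarrow> norm (integral {x - t..x} h0 /\<^sub>R t - h x) < e"
        using left[of x e] x e h0_x by auto
      have scale: "norm (v - t *\<^sub>R h x) \<le> e * t" if "0 < t" "norm (v /\<^sub>R t - h x) < e" for v t
      proof -
        have "v - t *\<^sub>R h x = t *\<^sub>R (v /\<^sub>R t - h x)" using that(1) by (simp add: scaleR_diff_right)
        then show ?thesis using that by (simp add: mult.commute)
      qed
      show "\<exists>d>0. \<forall>y. norm (y - x) < d \<longrightarrow>
          norm (integral {a..y} h0 - integral {a..x} h0 - (y - x) *\<^sub>R h x) \<le> e * norm (y - x)"
      proof (intro exI conjI allI impI)
        show "0 < min (x - a) (min d1 d2)" using x d1 d2 by auto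
        fix y assume y: "norm (y - x) < min (x - a) (min d1 d2)"
        consider "y = x" | "x < y" | "y < x" by linarith
        then show "norm (integral {a..y} h0 - integral {a..x} h0 - (y - x) *\<^sub>R h x) \<le> e * norm (y - x)"
        proof cases
          case 2
          then have "integral {a..y} h0 - integral {a..x} h0 = integral {x..y} h0"
            using comb[of x y] x by (simp add: algebra_simps)
          then show ?thesis using scale[of "y - x" "integral {x..y} h0"] d1(2)[of "y - x"] 2 y by simp
        next
          case 3
          then have eq: "integral {a..y} h0 - integral {a..x} h0 = - integral {y..x} h0"
            using comb[of y x] y by (simp add: algebra_simps)
          have "norm (integral {y..x} h0 - (x - y) *\<^sub>R h x) \<le> e * (x - y)"
            using scale[of "x - y" "integral {y..x} h0"] d2(2)[of "x - y"] 3 y by simp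
          moreover have "- integral {y..x} h0 - (y - x) *\<^sub>R h x = - (integral {y..x} h0 - (x - y) *\<^sub>R h x)"
            by (simp add: algebra_simps)
          ultimately show ?thesis using 3 unfolding eq by (simp only: norm_minus_cancel) simp
        qed simp
      qed
    qed
    then have "((\<lambda>u. integral {a..u} h) has_derivative (\<lambda>t. t *\<^sub>R h x)) (at x)"
    proof (rule has_derivative_transform_within_open)
      show "open {a<..<b}" "x \<in> {a<..<b}" using x by auto
      show "integral {a..u} h0 = integral {a..u} h" if "u \<in> {a<..<b}" for u
        using that by (intro Henstock_Kurzweil_Integration.integral_cong) (auto simp: h0_def)
    qed
    then show "((\<lambda>u. integral {a..u} h) has_vector_derivative h x) (at x)"
      unfolding has_vector_derivative_def .
  qed
qed

section \<open>Boundary values of isometric multipliers\<close>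

text \<open>Bridge between almost-everywhere statements of measure theory and the negligible sets of
  the gauge integral.\<close>

lemma AE_lebesgue_on_iff_negligible:
  assumes "S \<in> sets lebesgue"
  shows "(AE x in lebesgue_on S. P x) \<longleftrightarrow> (\<exists>N. negligible N \<and> (\<forall>x\<in>S - N. P x))"
proof -
  have "{x. \<not> (x \<in> S \<longrightarrow> P x)} \<subseteq> N \<longleftrightarrow> (\<forall>x\<in>S - N. P x)" for N by blast
  then show ?thesis
    using assms by (simp add: AE_restrict_space_iff eventually_ae_filter_negligible)
qed

text \<open>\<open>dominated_convergence\<close> asks for convergence at every point; resetting the
  functions and the limit to 0 on \<open>N\<close> provides it and changes no integral.\<close>

lemma bounded_convergence_negligible:
  fixes f :: "nat \<Rightarrow> real \<Rightarrow> 'b::euclidean_space"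
  assumes int: "\<And>k. f k integrable_on {a..b}" and N: "negligible N"
    and bound: "\<And>k x. x \<in> {a..b} \<Longrightarrow> norm (f k x) \<le> C"
    and lim: "\<And>x. x \<in> {a..b} - N \<Longrightarrow> (\<lambda>k. f k x) \<longlonglongrightarrow> g x"
  shows "g integrable_on {a..b}" and "(\<lambda>k. integral {a..b} (f k)) \<longlonglongrightarrow> integral {a..b} g"
proof -
  define f' where "f' k x = (if x \<in> N then 0 else f k x)" for k x
  define g' where "g' x = (if x \<in> N then 0 else g x)" for x
  have int': "f' k integrable_on {a..b}" for k
    by (rule integrable_spike[OF int N]) (simp add: f'_def)
  have bound': "norm (f' k x) \<le> max 0 C" if "x \<in> {a..b}" for k x
    using bound[OF that] by (auto simp: f'_def le_max_iff_disj)
  have lim': "(\<lambda>k. f' k x) \<longlonglongrightarrow> g' x" if "x \<in> {a..b}" for x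
    using lim[of x] that by (cases "x \<in> N") (auto simp: f'_def g'_def)
  have const: "(\<lambda>x. max 0 C) integrable_on {a..b}" by (rule integrable_const_ivl)
  have "g' integrable_on {a..b}"
    using int' const bound' lim' by (rule dominated_convergence(1))
  then show "g integrable_on {a..b}"
    by (rule integrable_spike[OF _ N]) (simp add: g'_def)
  have "(\<lambda>k. integral {a..b} (f' k)) \<longlonglongrightarrow> integral {a..b} g'"
    using int' const bound' lim' by (rule dominated_convergence(2))
  moreover have "integral {a..b} (f' k) = integral {a..b} (f k)" for k
    by (rule integral_spike[OF N]) (simp add: f'_def)
  moreover have "integral {a..b} g' = integral {a..b} g"
    by (rule integral_spike[OF N]) (simp add: g'_def)
  ultimately show "(\<lambda>k. integral {a..b} (f k)) \<longlonglongrightarrow> integral {a..b} g" by simp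
qed

lemma nonneg_integral_zero_negligible:
  fixes f :: "real \<Rightarrow> real"
  assumes "f integrable_on S" "S \<in> sets lebesgue" "\<And>x. x \<in> S \<Longrightarrow> 0 \<le> f x" "integral S f = 0"
  obtains N where "negligible N" "\<And>x. x \<in> S - N \<Longrightarrow> f x = 0"
proof -
  have int: "integrable (lebesgue_on S) f"
    using assms by (intro absolutely_integrable_imp_integrable nonnegative_absolutely_integrable_1)
  have nonneg: "AE x in lebesgue_on S. 0 \<le> f x"
    using assms(3) by (intro AE_I2) simp
  have "AE x in lebesgue_on S. f x = 0"
    using lebesgue_integral_eq_integral[OF int assms(2)] assms(4)
    unfolding integral_nonneg_eq_0_iff_AE[OF int nonneg, symmetric] by simp
  then show ?thesis
    unfolding AE_lebesgue_on_iff_negligible[OF assms(2)] using that by blast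
qed

text \<open>The sum of the increments \<open>d k\<close> has finite integral, hence is finite almost
  everywhere; there the telescoping series for \<open>F\<close> converges absolutely.\<close>

lemma summable_integral_imp_convergent_off_negligible:
  fixes F :: "nat \<Rightarrow> real \<Rightarrow> complex"
  assumes cont: "\<And>k. continuous_on {a..b} (F k)"
    and le: "\<And>k. integral {a..b} (\<lambda>x. cmod (F (Suc k) x - F k x)) \<le> c k" and c: "summable c"
  obtains N where "negligible N" "\<And>x. x \<in> {a..b} - N \<Longrightarrow> convergent (\<lambda>k. F k x)"
proof -
  let ?M = "lebesgue_on {a..b}"
  define d where "d k x = cmod (F (Suc k) x - F k x)" for k x
  have d_cont: "continuous_on {a..b} (d k)" for k
    unfolding d_def by (intro continuous_intros cont)
  have d_int: "integrable ?M (d k)" for k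
    by (rule continuous_imp_integrable_real[OF d_cont])
  have [measurable]: "d k \<in> borel_measurable ?M" for k
    using d_int by (rule borel_measurable_integrable)
  have d_nonneg: "0 \<le> d k x" for k x by (simp add: d_def)
  have c_nonneg: "0 \<le> c k" for k
  proof -
    have "0 \<le> integral {a..b} (d k)"
      by (intro Henstock_Kurzweil_Integration.integral_nonneg integrable_continuous_interval d_cont d_nonneg)
    then show ?thesis using le[of k] by (simp add: d_def[abs_def])
  qed
  have "(\<integral>\<^sup>+x. (\<Sum>k. ennreal (d k x)) \<partial>?M) = (\<Sum>k. \<integral>\<^sup>+x. ennreal (d k x) \<partial>?M)"
    by (intro nn_integral_suminf) measurable
  also have "\<dots> = (\<Sum>k. ennreal (integral {a..b} (d k)))"
    using d_int d_nonneg by (simp add: nn_integral_eq_integral lebesgue_integral_eq_integral)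
  also have "\<dots> \<le> (\<Sum>k. ennreal (c k))"
    using le by (intro suminf_le ennreal_leI) (auto simp: d_def[abs_def])
  also have "\<dots> = ennreal (\<Sum>k. c k)"
    using c c_nonneg by (intro suminf_ennreal2)
  finally have "(\<integral>\<^sup>+x. (\<Sum>k. ennreal (d k x)) \<partial>?M) \<noteq> \<infinity>"
    by (auto simp: top_unique)
  then have "AE x in ?M. (\<Sum>k. ennreal (d k x)) \<noteq> \<infinity>"
    by (intro nn_integral_PInf_AE) measurable
  then have "AE x in ?M. convergent (\<lambda>k. F k x)"
  proof eventually_elim
    fix x assume "(\<Sum>k. ennreal (d k x)) \<noteq> \<infinity>"
    then have "summable (\<lambda>k. d k x)"
      by (intro summable_suminf_not_top) (auto simp: d_nonneg)
    then have "summable (\<lambda>k. F (Suc k) x - F k x)"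
      unfolding d_def by (rule summable_norm_cancel)
    then have "convergent (\<lambda>n. \<Sum>k<n. F (Suc k) x - F k x)"
      by (simp add: summable_iff_convergent)
    then have "convergent (\<lambda>n. F n x - F 0 x)"
      using sum_lessThan_telescope[of "\<lambda>k. F k x"] by simp
    then show "convergent (\<lambda>k. F k x)"
      using convergent_diff_const_right_iff by blast
  qed
  then have "\<exists>N. negligible N \<and> (\<forall>x\<in>{a..b} - N. convergent (\<lambda>k. F k x))"
    by (subst (asm) AE_lebesgue_on_iff_negligible) simp
  then show ?thesis using that by blast
qed

text \<open>The means of \<open>\<phi>\<close> approach 1, so this is a Cauchy estimate in the mean
  square for its restrictions to circles. By Parseval it reduces to an inequality between
  coefficients.\<close>

lemma integral_circle_difference:
  assumes sums: "\<And>z. z \<in> ball 0 1 \<Longrightarrow> (\<lambda>n. l n * z ^ n) sums \<phi> z"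
    and norm1: "(\<lambda>n. (cmod (l n))\<^sup>2) sums 1"
    and r: "0 \<le> r" "r < 1" and s: "0 \<le> s" "s < 1"
  shows "integral {0..2*pi} (\<lambda>\<theta>. (cmod (\<phi> (of_real s * cis \<theta>) - \<phi> (of_real r * cis \<theta>)))\<^sup>2)
      \<le> 2 * pi * ((1 - (hardy_mean \<phi> r)\<^sup>2) + (1 - (hardy_mean \<phi> s)\<^sup>2))"
proof -
  \<comment> \<open>Any \<open>R\<close> strictly between both radii and 1 serves: the difference of
    two dilates of \<open>\<phi>\<close> becomes one function \<open>f\<close> on the circle of
    radius \<open>R\<close>, to which Parseval applies.\<close>
  define R where "R = (1 + max r s) / 2"
  have R: "0 < R" "R < 1" "r < R" "s < R" using r s by (auto simp: R_def)
  define f where "f z = \<phi> (of_real (s / R) * z) - \<phi> (of_real (r / R) * z)" for z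
  define b where "b n = l n * of_real ((s / R) ^ n - (r / R) ^ n)" for n
  have f_sums: "(\<lambda>n. b n * z ^ n) sums f z" if "z \<in> ball 0 1" for z
  proof -
    have "(\<lambda>n. l n * of_real (t ^ n) * z ^ n) sums \<phi> (of_real t * z)" if t: "0 \<le> t" "t \<le> 1" for t
    proof -
      have "t * cmod z \<le> 1 * cmod z" using t by (intro mult_right_mono) auto
      then have "of_real t * z \<in> ball 0 1" using \<open>z \<in> ball 0 1\<close> t by (simp add: norm_mult)
      from sums[OF this] show ?thesis by (simp add: power_mult_distrib mult.assoc)
    qed
    from sums_diff[OF this[of "s / R"] this[of "r / R"]]
    have "(\<lambda>n. l n * of_real ((s / R) ^ n) * z ^ n - l n * of_real ((r / R) ^ n) * z ^ n) sums f z"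
      unfolding f_def using r s R by simp
    then show ?thesis unfolding b_def of_real_diff right_diff_distrib left_diff_distrib .
  qed
  have "integral {0..2*pi} (\<lambda>\<theta>. (cmod (f (of_real R * cis \<theta>)))\<^sup>2) = 2 * pi * (hardy_mean f R)\<^sup>2"
    using hardy_mean_parseval(2)[OF f_sums, of R] R by (intro integral_unique) auto
  moreover have "f (of_real R * cis \<theta>) = \<phi> (of_real s * cis \<theta>) - \<phi> (of_real r * cis \<theta>)" for \<theta>
    using R by (simp add: f_def)
  moreover have "(hardy_mean f R)\<^sup>2 \<le> (1 - (hardy_mean \<phi> r)\<^sup>2) + (1 - (hardy_mean \<phi> s)\<^sup>2)"
  proof (rule sums_le)
    show "(\<lambda>n. (cmod (b n))\<^sup>2 * R ^ (2 * n)) sums (hardy_mean f R)\<^sup>2"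
      using hardy_mean_parseval(1)[OF f_sums, of R] R by auto
    show "(\<lambda>n. ((cmod (l n))\<^sup>2 - (cmod (l n))\<^sup>2 * r ^ (2 * n)) + ((cmod (l n))\<^sup>2 - (cmod (l n))\<^sup>2 * s ^ (2 * n)))
        sums ((1 - (hardy_mean \<phi> r)\<^sup>2) + (1 - (hardy_mean \<phi> s)\<^sup>2))"
      by (intro sums_add sums_diff norm1 hardy_mean_parseval(1) sums r s)
    fix n
    define x where "x = r ^ n"
    define y where "y = s ^ n"
    have xy: "0 \<le> x" "x \<le> 1" "0 \<le> y" "y \<le> 1" using r s by (auto simp: x_def y_def power_le_one)
    have "cmod (b n) * R ^ n = cmod (l n) * \<bar>y - x\<bar>"
    proof -
      have "\<bar>(s / R) ^ n - (r / R) ^ n\<bar> * R ^ n = \<bar>y - x\<bar>"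
        using R by (simp add: x_def y_def power_divide abs_mult flip: diff_divide_distrib)
      then show ?thesis by (simp only: b_def norm_mult norm_of_real mult.assoc)
    qed
    then have "(cmod (b n))\<^sup>2 * R ^ (2 * n) = (cmod (l n))\<^sup>2 * (y - x)\<^sup>2"
      by (metis power2_abs power_mult_distrib power_even_eq)
    also have "\<dots> \<le> (cmod (l n))\<^sup>2 * ((1 - x\<^sup>2) + (1 - y\<^sup>2))"
    proof (rule mult_left_mono)
      \<comment> \<open>The claim amounts to \<open>x\<^sup>2 + y\<^sup>2 - x * y \<le> 1\<close>;
        replacing the squares by \<open>x\<close> and \<open>y\<close> leaves
        \<open>(1 - x) * (1 - y) \<ge> 0\<close>.\<close>
      have "x * x \<le> x * 1" "y * y \<le> y * 1"
        using xy by (intro mult_left_mono; simp)+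
      moreover have "(1 - x) * (1 - y) \<ge> 0" using xy by simp
      ultimately show "(y - x)\<^sup>2 \<le> (1 - x\<^sup>2) + (1 - y\<^sup>2)"
        using xy by (simp add: power2_eq_square algebra_simps)
    qed simp
    finally have "(cmod (b n))\<^sup>2 * R ^ (2 * n) \<le> (cmod (l n))\<^sup>2 * ((1 - x\<^sup>2) + (1 - y\<^sup>2))" .
    moreover have "r ^ (2 * n) = x\<^sup>2" "s ^ (2 * n) = y\<^sup>2"
      by (simp_all add: x_def y_def power_even_eq)
    ultimately show "(cmod (b n))\<^sup>2 * R ^ (2 * n)
        \<le> ((cmod (l n))\<^sup>2 - (cmod (l n))\<^sup>2 * r ^ (2 * n)) + ((cmod (l n))\<^sup>2 - (cmod (l n))\<^sup>2 * s ^ (2 * n))"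
      by (simp add: right_diff_distrib distrib_left)
  qed
  ultimately show ?thesis by simp
qed

text \<open>The rate \<open>(1 / 4) ^ k\<close> for mean-square deficits becomes the summable rate
  \<open>(1 / 2) ^ k\<close> for mean absolute differences.\<close>

lemma radii_fast_sequence:
  fixes A :: "real \<Rightarrow> real"
  assumes "(A \<longlongrightarrow> 1) (at_left 1)"
  obtains r where "\<And>k. 0 < r k" "\<And>k. r k < 1" "r \<longlonglongrightarrow> 1" "\<And>k. 1 - A (r k) < (1 / 4) ^ k"
proof -
  \<comment> \<open>With \<open>Suc (Suc k)\<close> the left endpoint is at least 1/2, so the radii
    are positive.\<close>
  have "\<exists>t. t \<in> {1 - inverse (real (Suc (Suc k)))<..<1} \<and> 1 - (1 / 4) ^ k < A t" for k
  proof -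
    have "eventually (\<lambda>t. t \<in> {1 - inverse (real (Suc (Suc k)))<..<1}) (at_left 1)"
      by (intro eventually_at_left_real) (simp only: diff_less_eq, simp)
    moreover have "eventually (\<lambda>t. 1 - (1 / 4) ^ k < A t) (at_left 1)"
      by (rule order_tendstoD(1)[OF assms]) simp
    ultimately have "eventually (\<lambda>t. t \<in> {1 - inverse (real (Suc (Suc k)))<..<1} \<and> 1 - (1 / 4) ^ k < A t) (at_left 1)"
      by (rule eventually_conj)
    then show ?thesis by (rule eventually_happens'[OF trivial_limit_at_left_real])
  qed
  then obtain r where r: "\<And>k. r k \<in> {1 - inverse (real (Suc (Suc k)))<..<1}" "\<And>k. 1 - (1 / 4) ^ k < A (r k)"
    by metis
  show ?thesis
  proof
    show "0 < r k" for k
    proof -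
      have "inverse (real (Suc (Suc k))) \<le> 1" by (intro inverse_le_1_iff[THEN iffD2]) simp
      then show ?thesis using r(1)[of k] by (simp del: of_nat_Suc)
    qed
    show "r k < 1" for k using r(1)[of k] by simp
    have "(\<lambda>k. 1 + - inverse (real (Suc k))) \<longlonglongrightarrow> 1"
      by (rule LIMSEQ_inverse_real_of_nat_add_minus)
    then have "(\<lambda>k. 1 - inverse (real (Suc (Suc k)))) \<longlonglongrightarrow> 1"
      using LIMSEQ_Suc by fastforce
    then show "r \<longlonglongrightarrow> 1"
      by (rule tendsto_sandwich[OF _ _ _ tendsto_const, rotated 2])
        (use r(1) in \<open>auto intro!: always_eventually simp: less_imp_le simp del: of_nat_Suc\<close>)
    show "1 - A (r k) < (1 / 4) ^ k" for k using r(2)[of k] by simp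
  qed
qed

lemma inner_functionI:
  assumes sums: "\<And>z. z \<in> ball 0 1 \<Longrightarrow> (\<lambda>n. l n * z ^ n) sums \<phi> z"
    and norm1: "(\<lambda>n. (cmod (l n))\<^sup>2) sums 1"
    and le1: "\<And>z. z \<in> ball 0 1 \<Longrightarrow> cmod (\<phi> z) \<le> 1"
  shows "inner_function \<phi>"
proof -
  have hol: "\<phi> holomorphic_on ball 0 1"
    using power_series_holomorphic[of 0 1 l \<phi>] sums by simp
  define A where "A r = (hardy_mean \<phi> r)\<^sup>2" for r
  have A_lim: "(A \<longlongrightarrow> 1) (at_left 1)"
    using tendsto_power[OF hardy_mean_tendsto[OF sums], of 2] norm1
    by (simp add: A_def[abs_def] sums_iff)
  obtain r where r: "\<And>k. 0 < r k" "\<And>k. r k < 1" and r_lim: "r \<longlonglongrightarrow> 1"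
    and fast: "\<And>k. 1 - A (r k) < (1 / 4) ^ k"
    using radii_fast_sequence[OF A_lim] by metis
  have in_ball: "of_real (r k) * cis \<theta> \<in> ball 0 1" for k \<theta>
    using r[of k] by (simp add: norm_mult)
  define F where "F k \<theta> = \<phi> (of_real (r k) * cis \<theta>)" for k \<theta>
  have F_cont: "continuous_on S (F k)" for k S
    unfolding F_def
    by (rule continuous_on_compose2[OF holomorphic_on_imp_continuous_on[OF hol]])
      (use in_ball in \<open>auto intro!: continuous_intros\<close>)
  have F_le: "cmod (F k \<theta>) \<le> 1" for k \<theta>
    unfolding F_def by (rule le1[OF in_ball])

  \<comment> \<open>Almost everywhere convergence along the chosen radii\<close>
  have diff_le: "integral {0..2*pi} (\<lambda>\<theta>. cmod (F (Suc k) \<theta> - F k \<theta>)) \<le> 4 * pi * (1 / 2) ^ k" for k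
  proof -
    let ?d = "\<lambda>\<theta>. cmod (F (Suc k) \<theta> - F k \<theta>)"
    \<comment> \<open>Instead of Cauchy-Schwarz,
      \<open>2 * x * y \<le> x\<^sup>2 + y\<^sup>2\<close> is used pointwise; the weight
      \<open>2 ^ k\<close> balances the mean-square bound of order \<open>(1 / 4) ^ k\<close>
      against the constant.\<close>
    have "integral {0..2*pi} ?d \<le> integral {0..2*pi} (\<lambda>\<theta>. 2 ^ k / 2 * (?d \<theta>)\<^sup>2 + (1 / 2) ^ k / 2)"
    proof (rule Henstock_Kurzweil_Integration.integral_le)
      show "?d integrable_on {0..2*pi}"
        by (intro integrable_continuous_interval continuous_intros F_cont)
      show "(\<lambda>\<theta>. 2 ^ k / 2 * (?d \<theta>)\<^sup>2 + (1 / 2) ^ k / 2) integrable_on {0..2*pi}"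
        by (intro integrable_continuous_interval continuous_intros F_cont)
      fix \<theta>
      have "0 \<le> (2 ^ k * ?d \<theta> - 1)\<^sup>2 / (2 * 2 ^ k)" by simp
      also have "\<dots> = 2 ^ k / 2 * (?d \<theta>)\<^sup>2 + (1 / 2) ^ k / 2 - ?d \<theta>"
        by (simp add: power2_eq_square power_divide field_simps)
      finally show "?d \<theta> \<le> 2 ^ k / 2 * (?d \<theta>)\<^sup>2 + (1 / 2) ^ k / 2" by simp
    qed
    also have "\<dots> = 2 ^ k / 2 * integral {0..2*pi} (\<lambda>\<theta>. (?d \<theta>)\<^sup>2) + pi * (1 / 2) ^ k"
      by (subst Henstock_Kurzweil_Integration.integral_add)
        (auto intro!: integrable_continuous_interval continuous_intros F_cont)
    also have "\<dots> \<le> 2 ^ k / 2 * (2 * pi * (2 * (1 / 4) ^ k)) + pi * (1 / 2) ^ k"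
    proof -
      have "integral {0..2*pi} (\<lambda>\<theta>. (?d \<theta>)\<^sup>2) \<le> 2 * pi * ((1 - A (r k)) + (1 - A (r (Suc k))))"
        unfolding F_def A_def using r by (intro integral_circle_difference[OF sums norm1]) (auto intro: less_imp_le)
      also have "\<dots> \<le> 2 * pi * (2 * (1 / 4) ^ k)"
      proof (rule mult_left_mono)
        have "(1 / 4 :: real) ^ Suc k \<le> (1 / 4) ^ k" by simp
        then show "(1 - A (r k)) + (1 - A (r (Suc k))) \<le> 2 * (1 / 4) ^ k"
          using fast[of k] fast[of "Suc k"] by linarith
      qed simp
      finally show ?thesis by (intro add_mono mult_left_mono) auto
    qed
    also have "\<dots> = 3 * pi * (1 / 2) ^ k"
    proof -
      have "(2::real) ^ k * (1 / 4) ^ k = (1 / 2) ^ k" by (simp flip: power_mult_distrib)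
      then show ?thesis by (simp add: mult_ac)
    qed
    also have "\<dots> \<le> 4 * pi * (1 / 2) ^ k" by simp
    finally show ?thesis .
  qed
  have summ: "summable (\<lambda>k. 4 * pi * (1 / 2) ^ k)"
    by (intro summable_mult summable_geometric) simp
  obtain N0 where N0: "negligible N0" and conv: "\<And>\<theta>. \<theta> \<in> {0..2*pi} - N0 \<Longrightarrow> convergent (\<lambda>k. F k \<theta>)"
    using summable_integral_imp_convergent_off_negligible[where F = F and a = 0 and b = "2 * pi",
        OF F_cont diff_le summ] by blast
  define g where "g \<theta> = lim (\<lambda>k. F k \<theta>)" for \<theta>
  have F_lim: "(\<lambda>k. F k \<theta>) \<longlonglongrightarrow> g \<theta>" if "\<theta> \<in> {0..2*pi} - N0" for \<theta>
    using conv[OF that] by (simp add: g_def convergent_LIMSEQ_iff)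

  \<comment> \<open>Unimodularity of the limit\<close>
  obtain N1 where N1: "negligible N1" and g1: "\<And>\<theta>. \<theta> \<in> {0..2*pi} - N1 \<Longrightarrow> cmod (g \<theta>) = 1"
  proof -
    \<comment> \<open>On \<open>N0\<close> the value \<open>lim\<close> is arbitrary, so
      \<open>q\<close> is set to 0 there to be nonnegative everywhere. Its integral is the limit of
      \<open>2 * pi * (1 - A (r k))\<close>, that is 0.\<close>
    define q where "q \<theta> = (if \<theta> \<in> N0 then 0 else 1 - (cmod (g \<theta>))\<^sup>2)" for \<theta>
    have lim_q: "(\<lambda>k. 1 - (cmod (F k \<theta>))\<^sup>2) \<longlonglongrightarrow> q \<theta>" if "\<theta> \<in> {0..2*pi} - N0" for \<theta>
      using F_lim[OF that] that unfolding q_def by (auto intro!: tendsto_intros)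
    have int: "(\<lambda>\<theta>. 1 - (cmod (F k \<theta>))\<^sup>2) integrable_on {0..2*pi}" for k
      by (intro integrable_continuous_interval continuous_intros F_cont)
    have F_sq: "(cmod (F k \<theta>))\<^sup>2 \<le> 1" for k \<theta>
      using F_le[of k \<theta>] by (simp add: power_le_one)
    then have bound: "norm (1 - (cmod (F k \<theta>))\<^sup>2) \<le> 1" for k \<theta> by simp
    have q_conv: "q integrable_on {0..2*pi}"
      "(\<lambda>k. integral {0..2*pi} (\<lambda>\<theta>. 1 - (cmod (F k \<theta>))\<^sup>2)) \<longlonglongrightarrow> integral {0..2*pi} q"
      by (rule bounded_convergence_negligible[OF int N0 bound]; erule lim_q)+
    have "integral {0..2*pi} (\<lambda>\<theta>. 1 - (cmod (F k \<theta>))\<^sup>2) = 2 * pi * (1 - A (r k))" for k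
    proof -
      have "((\<lambda>\<theta>. (cmod (F k \<theta>))\<^sup>2) has_integral 2 * pi * A (r k)) {0..2*pi}"
        unfolding F_def A_def using r[of k] by (intro hardy_mean_parseval(2)[OF sums]) auto
      from has_integral_diff[OF has_integral_const_real[of 1 0 "2*pi"] this]
      show ?thesis by (simp add: integral_unique right_diff_distrib)
    qed
    moreover have "(\<lambda>k. 2 * pi * (1 - A (r k))) \<longlonglongrightarrow> 2 * pi * (1 - 1)"
    proof -
      have "filterlim r (at_left 1) sequentially"
        using r r_lim by (auto simp: filterlim_at less_le intro!: always_eventually)
      from filterlim_compose[OF A_lim this] show ?thesis by (intro tendsto_intros)
    qed
    ultimately have "(\<lambda>k. integral {0..2*pi} (\<lambda>\<theta>. 1 - (cmod (F k \<theta>))\<^sup>2)) \<longlonglongrightarrow> 0"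
      by simp
    then have "integral {0..2*pi} q = 0"
      by (rule LIMSEQ_unique[OF q_conv(2)])
    moreover have "0 \<le> q \<theta>" if "\<theta> \<in> {0..2*pi}" for \<theta>
    proof (cases "\<theta> \<in> N0")
      case False
      show ?thesis by (rule LIMSEQ_le_const[OF lim_q]) (use False that F_sq in auto)
    qed (simp add: q_def)
    ultimately obtain N where N: "negligible N" "\<And>\<theta>. \<theta> \<in> {0..2*pi} - N \<Longrightarrow> q \<theta> = 0"
      using nonneg_integral_zero_negligible[OF q_conv(1)] by auto
    show ?thesis
    proof
      show "negligible (N0 \<union> N)" using N0 N(1) by simp
      fix \<theta> assume \<theta>: "\<theta> \<in> {0..2*pi} - (N0 \<union> N)"
      then have "(cmod (g \<theta>))\<^sup>2 = 1" using N(2)[of \<theta>] by (simp add: q_def)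
      then show "cmod (g \<theta>) = 1" by (metis abs_norm_cancel power2_eq_1_iff abs_1 abs_minus_cancel)
    qed
  qed

  \<comment> \<open>A primitive of \<open>\<phi>\<close> and its boundary values\<close>
  obtain G0 where G0: "\<And>z. z \<in> ball 0 1 \<Longrightarrow> (G0 has_field_derivative \<phi> z) (at z within ball 0 1)"
    using holomorphic_convex_primitive'[OF _ _ hol] by auto
  \<comment> \<open>The disk is convex and the derivative \<open>\<phi>\<close> has modulus at most
    1; a Lipschitz function extends to the closure.\<close>
  have "1-lipschitz_on (ball 0 1) G0"
    by (rule lipschitz_onI)
      (use field_differentiable_bound[OF convex_ball G0 le1] in \<open>auto simp: dist_norm\<close>)
  then obtain G where G: "1-lipschitz_on (cball 0 1) G" and G_eq: "\<And>z. z \<in> ball 0 1 \<Longrightarrow> G z = G0 z"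
    using lipschitz_extend_closure[of 1 "ball 0 1" G0] by auto
  have G_deriv: "(G has_field_derivative \<phi> z) (at z)" if z: "z \<in> ball 0 1" for z
  proof (rule has_field_derivative_transform_within_open[where f = G0 and S = "ball 0 1"])
    show "(G0 has_field_derivative \<phi> z) (at z)" using G0[OF z] z by (simp add: at_within_open[of z "ball 0 1"])
  qed (use z G_eq in auto)
  \<comment> \<open>The formal derivative of \<open>G (cis \<theta>)\<close> in the angle, with
    \<open>g\<close> in place of \<open>\<phi>\<close>.\<close>
  define h where "h \<theta> = \<i> * cis \<theta> * g \<theta>" for \<theta>
  \<comment> \<open>At radius \<open>r k\<close> this is the fundamental theorem of calculus.
    Bounded convergence handles the integral and continuity of \<open>G\<close> the endpoint values
    as \<open>k\<close> grows.\<close>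
  have h_int: "h integrable_on {0..u} \<and> integral {0..u} h = G (cis u) - G (cis 0)" if u: "0 \<le> u" "u \<le> 2 * pi" for u
  proof -
    let ?f = "\<lambda>k \<theta>. of_real (r k) * (\<i> * cis \<theta>) * F k \<theta>"
    have lim_f: "(\<lambda>k. ?f k \<theta>) \<longlonglongrightarrow> h \<theta>" if "\<theta> \<in> {0..u} - N0" for \<theta>
    proof -
      have "(\<lambda>k. ?f k \<theta>) \<longlonglongrightarrow> of_real 1 * (\<i> * cis \<theta>) * g \<theta>"
        using that u by (intro tendsto_intros r_lim F_lim) auto
      then show ?thesis by (simp add: h_def)
    qed
    have bound: "norm (?f k \<theta>) \<le> 1" for k \<theta>
    proof -
      have "norm (?f k \<theta>) = r k * cmod (F k \<theta>)" using r[of k] by (simp add: norm_mult)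
      also have "\<dots> \<le> 1 * 1" using r[of k] F_le[of k \<theta>] by (intro mult_mono) auto
      finally show ?thesis by simp
    qed
    have int: "?f k integrable_on {0..u}" for k
      by (intro integrable_continuous_interval continuous_intros F_cont)
    have h_conv: "h integrable_on {0..u}" "(\<lambda>k. integral {0..u} (?f k)) \<longlonglongrightarrow> integral {0..u} h"
      by (rule bounded_convergence_negligible[OF int N0 bound]; erule lim_f)+
    have "integral {0..u} (?f k) = G (of_real (r k) * cis u) - G (of_real (r k) * cis 0)" for k
    proof (intro integral_unique fundamental_theorem_of_calculus)
      fix x
      have "cis x = exp (\<i> * of_real x)" for x by (simp add: cis_conv_exp)
      then have "((\<lambda>\<theta>. of_real (r k) * cis \<theta>) has_vector_derivative of_real (r k) * (\<i> * cis x)) (at x)"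
        by (auto intro!: derivative_eq_intros has_vector_derivative_real_field)
      from field_vector_diff_chain_at[OF this G_deriv[OF in_ball]]
      show "((\<lambda>\<theta>. G (of_real (r k) * cis \<theta>)) has_vector_derivative ?f k x) (at x within {0..u})"
        by (simp add: o_def F_def has_vector_derivative_at_within)
    qed (use u in auto)
    moreover have "(\<lambda>k. G (of_real (r k) * cis \<theta>)) \<longlonglongrightarrow> G (cis \<theta>)" for \<theta>
    proof (rule continuous_on_tendsto_compose[OF lipschitz_on_continuous_on[OF G]])
      have "(\<lambda>k. of_real (r k) * cis \<theta>) \<longlonglongrightarrow> of_real 1 * cis \<theta>" by (intro tendsto_intros r_lim)
      then show "(\<lambda>k. of_real (r k) * cis \<theta>) \<longlonglongrightarrow> cis \<theta>" by simp
      show "eventually (\<lambda>k. of_real (r k) * cis \<theta> \<in> cball 0 1) sequentially"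
        using in_ball ball_subset_cball by (intro always_eventually allI) blast
    qed simp
    ultimately have "(\<lambda>k. integral {0..u} (?f k)) \<longlonglongrightarrow> G (cis u) - G (cis 0)"
      by (simp only: tendsto_diff)
    then show ?thesis using h_conv(1) LIMSEQ_unique[OF h_conv(2)] by blast
  qed
  have "h integrable_on {0..2*pi}" using h_int[of "2*pi"] by simp
  then obtain N2 where N2: "negligible N2" and h_deriv: "\<And>\<theta>. \<theta> \<in> {0<..<2*pi} - N2 \<Longrightarrow>
      ((\<lambda>u. integral {0..u} h) has_vector_derivative h \<theta>) (at \<theta>)"
    using indefinite_integral_has_vector_derivative_ae by metis

  \<comment> \<open>The endpoints are excluded because the derivative in the angle is two-sided.
    Radial convergence now holds for all \<open>r\<close> tending to 1, not just along
    \<open>r k\<close>.\<close>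
  have "\<exists>w. ((\<lambda>r::real. \<phi> (of_real r * cis \<theta>)) \<longlongrightarrow> w) (at_left 1) \<and> cmod w = 1"
    if \<theta>: "\<theta> \<in> {0..2*pi} - (N1 \<union> N2 \<union> {0, 2*pi})" for \<theta>
  proof (intro exI conjI)
    show "cmod (g \<theta>) = 1" using g1 \<theta> by simp
    have "((\<lambda>u. G (cis u)) has_vector_derivative h \<theta>) (at \<theta>)"
    proof (rule has_vector_derivative_transform_within_open)
      show "((\<lambda>u. integral {0..u} h + G (cis 0)) has_vector_derivative h \<theta>) (at \<theta>)"
        using h_deriv[of \<theta>] \<theta> by (auto intro!: derivative_eq_intros)
      show "open {0<..<2*pi}" by simp
      show "\<theta> \<in> {0<..<2*pi}" using \<theta> by auto
      show "integral {0..u} h + G (cis 0) = G (cis u)" if "u \<in> {0<..<2*pi}" for u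
        using h_int[of u] that by simp
    qed
    then have "((\<lambda>u. G (cis u)) has_vector_derivative \<i> * cis \<theta> * g \<theta>) (at \<theta>)"
      by (simp add: h_def)
    from circle_derivative_imp_boundary[OF this]
    show "((\<lambda>r::real. \<phi> (of_real r * cis \<theta>)) \<longlongrightarrow> g \<theta>) (at_left 1)"
      by (intro radial_limit_of_boundary_derivative[OF G G_deriv]) auto
  qed
  moreover have "negligible (N1 \<union> N2 \<union> {0, 2*pi})" using N1 N2 by simp
  ultimately have "AE \<theta> in lebesgue_on {0..2*pi}.
      \<exists>w. ((\<lambda>r::real. \<phi> (of_real r * cis \<theta>)) \<longlongrightarrow> w) (at_left 1) \<and> cmod w = 1"
    by (subst AE_lebesgue_on_iff_negligible) (simp, blast)
  then show ?thesis unfolding inner_function_def using hol le1 by blast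
qed

text \<open>Every Taylor coefficient is bounded by the norm, so the series is dominated by a
  geometric one. The constant is crude, but it depends on \<open>z\<close> alone, which is what the
  argument with powers of \<open>\<phi>\<close> requires.\<close>

lemma hardy_norm_pointwise_bound:
  assumes f: "f \<in> hardy_space" and z: "z \<in> ball 0 1"
  shows "cmod (f z) * (1 - cmod z) \<le> hardy_norm f"
proof -
  define b where "b n = (deriv ^^ n) f 0 / fact n" for n
  have sums: "(\<lambda>n. b n * w ^ n) sums f w" if "w \<in> ball 0 1" for w
    using holomorphic_power_series[of f 0 1 w] f that by (simp add: b_def hardy_space_def)
  have summ: "summable (\<lambda>n. (cmod (b n))\<^sup>2)" and norm: "hardy_norm f = sqrt (\<Sum>n. (cmod (b n))\<^sup>2)"
    using hardy_space_iff_summable[OF sums] f by blast+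
  have b_le: "cmod (b n) \<le> hardy_norm f" for n
  proof -
    have "(\<Sum>k\<in>{n}. (cmod (b k))\<^sup>2) \<le> (\<Sum>k. (cmod (b k))\<^sup>2)"
      by (intro sum_le_suminf summ) auto
    then show ?thesis unfolding norm by (intro real_le_rsqrt) simp
  qed
  have geom: "(\<lambda>n. hardy_norm f * cmod z ^ n) sums (hardy_norm f * (1 / (1 - cmod z)))"
    using z by (intro sums_mult geometric_sums) simp
  have "cmod (f z) \<le> hardy_norm f * (1 / (1 - cmod z))"
    unfolding sums_unique[OF sums[OF z]] sums_unique[OF geom]
    using b_le by (intro norm_suminf_le sums_summable[OF geom]) (simp add: norm_mult norm_power mult_right_mono)
  then show ?thesis using z by (simp add: field_simps)
qed

lemma hardy_space_one: "(\<lambda>z. 1) \<in> hardy_space" "hardy_norm (\<lambda>z. 1) = 1"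
proof -
  let ?b = "\<lambda>n. if n = 0 then 1 else 0 :: complex"
  have sums: "(\<lambda>n. ?b n * z ^ n) sums 1" for z
    using sums_finite[of "{0}" "\<lambda>n. ?b n * z ^ n"] by simp
  have sq: "(\<lambda>n. (cmod (?b n))\<^sup>2) sums 1"
    using sums_finite[of "{0}" "\<lambda>n. (cmod (?b n))\<^sup>2"] by simp
  show one: "(\<lambda>z. 1) \<in> hardy_space"
    using hardy_space_iff_summable(1)[OF sums] sums_summable[OF sq] by blast
  show "hardy_norm (\<lambda>z. 1) = 1"
    using hardy_space_iff_summable(2)[OF sums one] sums_unique[OF sq] by simp
qed

text \<open>Starting from the constant 1, every power of \<open>\<phi>\<close> has norm 1. The first
  power gives the coefficient norm; the pointwise bound for all powers gives
  \<open>cmod (\<phi> z) \<le> 1\<close> through \<open>le_of_power_le\<close>.\<close>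

lemma isometric_multiplier_inner:
  assumes sums: "\<And>z. z \<in> ball 0 1 \<Longrightarrow> (\<lambda>n. l n * z ^ n) sums \<phi> z"
    and mult: "\<And>f. f \<in> hardy_space \<Longrightarrow>
      (\<lambda>z. \<phi> z * f z) \<in> hardy_space \<and> hardy_norm (\<lambda>z. \<phi> z * f z) = hardy_norm f"
  shows "inner_function \<phi>"
proof (rule inner_functionI[OF sums])
  have power: "(\<lambda>z. \<phi> z ^ k) \<in> hardy_space \<and> hardy_norm (\<lambda>z. \<phi> z ^ k) = 1" for k
    by (induction k) (use hardy_space_one mult in auto)
  have "\<phi> \<in> hardy_space" "hardy_norm \<phi> = 1" using power[of 1] by simp_all
  then show "(\<lambda>n. (cmod (l n))\<^sup>2) sums 1"
    using hardy_space_iff_summable[OF sums] by (simp add: sums_iff)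
  show "cmod (\<phi> z) \<le> 1" if z: "z \<in> ball 0 1" for z
  proof (rule le_of_power_le)
    show "cmod (\<phi> z) ^ k * (1 - cmod z) \<le> 1 * 1 ^ k" for k
      using hardy_norm_pointwise_bound[of "\<lambda>z. \<phi> z ^ k", OF _ z] power[of k] by (simp add: norm_power)
  qed (use z in auto)
qed

theorem theorem1:
  fixes \<phi> :: "complex \<Rightarrow> complex" and l :: "nat \<Rightarrow> complex"
  assumes "\<phi> holomorphic_on ball 0 1"
    and "\<And>z. z \<in> ball 0 1 \<Longrightarrow> (\<lambda>n. l n * z ^ n) sums \<phi> z"
  defines "cond_a \<equiv> inner_function \<phi>"
    and "cond_b \<equiv> (\<forall>f\<in>hardy_space. (\<lambda>z. \<phi> z * f z) \<in> hardy_space \<and>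
                      hardy_norm (\<lambda>z. \<phi> z * f z) = hardy_norm f)"
    and "cond_c \<equiv> (\<forall>a :: nat \<Rightarrow> complex. summable (\<lambda>n. (cmod (a n))\<^sup>2) \<longrightarrow>
                      summable (\<lambda>n. (cmod (\<Sum>j\<le>n. a j * l (n - j)))\<^sup>2) \<and>
                      (\<Sum>n. (cmod (\<Sum>j\<le>n. a j * l (n - j)))\<^sup>2) = (\<Sum>n. (cmod (a n))\<^sup>2))"
    and "cond_d \<equiv> (\<forall>(N :: nat) (a :: nat \<Rightarrow> complex).
                      summable (\<lambda>m. (cmod (\<Sum>j\<le>N. a j * l (N + 1 + m - j)))\<^sup>2) \<and>
                      (\<Sum>n\<le>N. (cmod (\<Sum>j\<le>n. a j * l (n - j)))\<^sup>2)
                        + (\<Sum>m. (cmod (\<Sum>j\<le>N. a j * l (N + 1 + m - j)))\<^sup>2)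
                      = (\<Sum>n\<le>N. (cmod (a n))\<^sup>2))"
  shows "(cond_a \<longleftrightarrow> cond_b) \<and> (cond_b \<longleftrightarrow> cond_c) \<and> (cond_c \<longleftrightarrow> cond_d)"
proof -
  note b_iff_c = isometric_multiplier_iff[OF assms(2)]
  have c: "cond_c \<longleftrightarrow> (\<forall>a. summable (\<lambda>n. (cmod (a n))\<^sup>2) \<longrightarrow>
      (\<lambda>n. (cmod (\<Sum>j\<le>n. a j * l (n - j)))\<^sup>2) sums (\<Sum>n. (cmod (a n))\<^sup>2))"
    unfolding cond_c_def sums_iff ..
  have bc: "cond_b \<longleftrightarrow> cond_c"
    unfolding c cond_b_def by (rule b_iff_c)
  have cd: "cond_c \<longleftrightarrow> cond_d"
    unfolding c cond_d_def square_summable_isometry_iff_finite by (rule finite_isometry_split_iff)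
  \<comment> \<open>An inner function gives the isometry on finitely supported sequences, and
    density extends it to all square-summable ones.\<close>
  have "cond_c" if cond_a
    using inner_function_finite_isometry[OF that[unfolded cond_a_def] assms(2)]
    unfolding c square_summable_isometry_iff_finite by blast
  moreover have "cond_a" if cond_b
    using isometric_multiplier_inner[OF assms(2)] that unfolding cond_a_def cond_b_def by blast
  ultimately show ?thesis using bc cd by blast
qed

end
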